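(* Let $u$ be a fixed sequence with $\|u\|=r$ distinct symbols and length $|u|=s$, where $s\ge r+3$, and let $t=\lfloor (s-r-2)/2\rfloor$. Then, as $n\to\infty$, \[ \mathrm{Ex}_u(n)\le \begin{cases} n\cdot 2^{(1/t!)\,\alpha(n)^t+O\left(\alpha(n)^{t-1}\right)}, & s-r \text{ even},\\[2pt] n\cdot 2^{(1/t!)\,\alpha(n)^t\log_2\alpha(n)+O\left(\alpha(n)^{t}\right)}, & s-r \text{ odd}, \end{cases} \] where the constants implicit in the $O$-notation depend on $r$ and $s$.
   Context: For a sequence $S$, $|S|$ is its length and $\|S\|$ its number of distinct symbols. $S$ contains $u$ if $S$ has a (not necessarily contiguous) subsequence that can be made equal to $u$ by a one-to-one renaming of symbols; otherwise $S$ is $u$-free. A sequence $a_1a_2\ldots$ is $r$-sparse if $a_i\ne a_j$ whenever $1\le|i-j|\le r-1$. $\mathrm{Ex}_u(n)$ is the maximum length of an $r$-sparse, $u$-free sequence on $n$ distinct symbols, where $r=\|u\|$. The inverse Ackermann hierarchy: $\alpha_1(x)=\lceil x/2\rceil$; for $k\ge2$, $\alpha_k(x)=0$ if $x\le1$ and $\alpha_k(x)=1+\alpha_k(\alpha_{k-1}(x))$ otherwise. The inverse Ackermann function is $\alpha(x)=\min\{k\mid\alpha_k(x)\le3\}$. *)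

theory Defs
  imports
    Complex_Main
    "HOL-Library.Sublist"
    "HOL-Library.Extended_Real"
    "HOL-Library.Landau_Symbols"
begin

definition num_symbols :: "'a list \<Rightarrow> nat" where
  "num_symbols S = card (set S)"

definition contains :: "'b list \<Rightarrow> 'a list \<Rightarrow> bool" where
  "contains S u \<longleftrightarrow> (\<exists>T f. subseq T S \<and> inj_on f (set T) \<and> map f T = u)"

definition sparse :: "nat \<Rightarrow> 'a list \<Rightarrow> bool" where
  "sparse r S \<longleftrightarrow>
     (\<forall>i < length S. \<forall>j < length S.
        1 \<le> \<bar>int i - int j\<bar> \<and> \<bar>int i - int j\<bar> \<le> int r - 1 \<longrightarrow> S ! i \<noteq> S ! j)"

text \<open>Sequences are compared up to renaming of symbols, so natural numbers serve as the
  (infinite) supply of symbols.\<close>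

definition free_seqs :: "'a list \<Rightarrow> nat \<Rightarrow> nat list set" where
  "free_seqs u n =
     {S. num_symbols S = n \<and> sparse (num_symbols u) S \<and> \<not> contains S u}"

text \<open>The maximum is taken in \<^typ>\<open>enat\<close>: it is \<open>\<infinity>\<close> when the lengths are unbounded, so a real
  upper bound on \<open>ex_len u n\<close> asserts in particular that the maximum exists.\<close>

definition ex_len :: "'a list \<Rightarrow> nat \<Rightarrow> enat" where
  "ex_len u n = (SUP S \<in> free_seqs u n. enat (length S))"

lemma ex_len_eq_Max:
  assumes "finite (length ` free_seqs u n)" and "free_seqs u n \<noteq> {}"
  shows "ex_len u n = enat (Max (length ` free_seqs u n))"
proof -
  have "ex_len u n = Max (enat ` length ` free_seqs u n)"
    using assms by (simp add: ex_len_def Sup_enat_def image_image finite_imageI[of "length ` _" enat, simplified image_image])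
  also have "\<dots> = enat (Max (length ` free_seqs u n))"
    using assms by (intro mono_Max_commute[symmetric]) (auto intro: monoI)
  finally show ?thesis .
qed

text \<open>The inverse Ackermann hierarchy \<open>\<alpha>\<^sub>k\<close> for \<open>k \<ge> 1\<close>, at natural arguments (on which all its values
  are again natural numbers). The value at \<open>k = 0\<close> is a dummy.\<close>

function (domintros) ackinv_level :: "nat \<Rightarrow> nat \<Rightarrow> nat" where
  "ackinv_level k x =
     (if k \<le> 1 then nat \<lceil>real x / 2\<rceil>
      else if x \<le> 1 then 0
      else 1 + ackinv_level k (ackinv_level (k - 1) x))"
  by auto

lemma ackinv_level_less_dom:
  "ackinv_level_dom (k, x) \<Longrightarrow> x > 1 \<Longrightarrow> ackinv_level k x < x"
proof (induction k x rule: ackinv_level.pinduct)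
  case (1 k x)
  show ?case
  proof (cases "k \<le> 1")
    case True
    have "nat \<lceil>real x / 2\<rceil> < x"
      using \<open>x > 1\<close> by linarith
    then show ?thesis
      using True by (subst ackinv_level.psimps[OF "1.hyps"]) (use \<open>x > 1\<close> in auto)
  next
    case False
    let ?y = "ackinv_level (k - 1) x"
    have y: "?y < x"
      using 1 False by simp
    have "1 + ackinv_level k ?y < x"
    proof (cases "?y > 1")
      case True
      then show ?thesis
        using 1 False y by force
    next
      case le: False
      have dom: "ackinv_level_dom (k, ?y)"
        by (rule ackinv_level.domintros) (use le in simp_all)
      show ?thesis
        using False le \<open>x > 1\<close> by (subst ackinv_level.psimps[OF dom]) auto
    qed
    then show ?thesis
      using False \<open>x > 1\<close> by (subst ackinv_level.psimps[OF "1.hyps"]) (use \<open>x > 1\<close> in auto)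
  qed
qed

termination ackinv_level
  by (relation "less_than <*lex*> less_than") (auto intro: ackinv_level_less_dom)

declare ackinv_level.simps [simp del]

definition ackinv :: "nat \<Rightarrow> nat" where
  "ackinv x = (LEAST k. k \<ge> 1 \<and> ackinv_level k x \<le> 3)"

end

(* The upper-bound technique of Nivasch. A sequence with at least s - r + 1 consecutive pieces, each
   containing the same r symbols, contains u, so it suffices to bound formation-free sequences. Split
   into blocks and record for each symbol only the set of blocks in which it occurs. If every symbol
   occurs in more than a threshold number of blocks, the number of symbols is bounded by grouping the
   blocks into layers and counting symbols by where they are frequent; inside a first or last (middle)
   layer the formations are shorter by one (two) permutations. The resulting recurrence follows that of
   the inverse Ackermann hierarchy, and the threshold needed at level \<alpha>(n) is the factor
   2^((1/t!) \<alpha>(n)^t + ...). Lengths are recovered by cutting the occurrences of a symbol into chunks of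
   threshold size, and r-sparse sequences reduce to block sequences at first and last occurrences. *)

theory Submission
  imports Defs
begin

section \<open>Formations in block systems\<close>

text \<open>Contracting a sequence to layers would destroy its sparseness, whereas systems of block
  sets are closed under contraction, and contraction creates no formations. The shape of the bound
  comes from the threshold recursion T_v(d) = 2 T_(v-1)(d) + T_(v-2)(d) T_v(d-1), where v + 2 is the
  order of the forbidden formation and d the level of the hierarchy. To leading order log2 T_v(d) -
  log2 T_v(d-1) is log2 T_(v-2)(d), so two more orders mean one more summation over d, and t
  summations give d^t / t!. Odd v start from T_1 = 2; even v start from T_2(d) = 4 d, whence the
  factor log2 d in the exponent. The first and last layers, of order v - 1, enter additively and
  only affect the error term. Passing to lengths multiplies thresholds whose orders have the same
  parity, and only the largest reaches the leading exponent. The level is d = \<alpha>(n), because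
  then \<alpha>_d(n) is at most 3 and the factor polynomial in \<alpha>_d(n) is a constant.\<close>

text \<open>The usual formation with the order inside each permutation forgotten: \<open>s\<close>
  consecutive disjoint intervals of blocks, each meeting every symbol of \<open>X\<close>. A single
  block can serve only one of the intervals.\<close>

primrec formation :: "nat \<Rightarrow> ('a \<Rightarrow> nat set) \<Rightarrow> 'a set \<Rightarrow> nat \<Rightarrow> nat \<Rightarrow> bool" where
  "formation 0 B X l h \<longleftrightarrow> l \<le> h"
| "formation (Suc s) B X l h \<longleftrightarrow>
     (\<exists>c \<le> h. formation s B X l c \<and> (\<forall>x\<in>X. \<exists>b\<in>B x. c \<le> b \<and> b < h))"

definition formation_free :: "nat \<Rightarrow> nat \<Rightarrow> 'a set \<Rightarrow> ('a \<Rightarrow> nat set) \<Rightarrow> nat \<Rightarrow> nat \<Rightarrow> bool" where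
  "formation_free r s A B l h \<longleftrightarrow> (\<forall>X \<subseteq> A. card X = r \<longrightarrow> \<not> formation s B X l h)"

lemma formation_le: "formation s B X l h \<Longrightarrow> l \<le> h"
  by (induction s arbitrary: h) (auto intro: order.trans)

lemma formation_mono:
  assumes "formation s B X l h" "l' \<le> l" "h \<le> h'" "\<And>x. x \<in> X \<Longrightarrow> B x \<inter> {l..<h} \<subseteq> B' x"
  shows "formation s B' X l' h'"
  using assms
proof (induction s arbitrary: h h')
  case 0
  then show ?case by simp
next
  case (Suc s)
  from Suc.prems(1) obtain c where c: "c \<le> h" "formation s B X l c"
    "\<forall>x\<in>X. \<exists>b\<in>B x. c \<le> b \<and> b < h" by auto
  have sub: "B x \<inter> {l..<c} \<subseteq> B' x" if "x \<in> X" for x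
    using Suc.prems(4)[OF that] c(1) by fastforce
  have "formation s B' X l' c"
    by (rule Suc.IH[OF c(2) Suc.prems(2) order_refl]) (rule sub)
  moreover have "\<forall>x\<in>X. \<exists>b\<in>B' x. c \<le> b \<and> b < h'"
  proof
    fix x assume x: "x \<in> X"
    obtain b where b: "b \<in> B x" "c \<le> b" "b < h" using c(3) x by blast
    have "l \<le> b" using formation_le[OF c(2)] b(2) by linarith
    then have "b \<in> B' x" using Suc.prems(4)[OF x] b by auto
    then show "\<exists>b\<in>B' x. c \<le> b \<and> b < h'"
      using Suc.prems(3) b by (intro bexI[of _ b]) auto
  qed
  moreover have "c \<le> h'" using c(1) Suc.prems(3) by simp
  ultimately show ?case unfolding formation.simps(2) by (intro exI[of _ c] conjI)
qed

lemma formation_append: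
  assumes "formation s B X l c" "\<forall>x\<in>X. \<exists>b\<in>B x. c \<le> b \<and> b < h" "c \<le> h"
  shows "formation (Suc s) B X l h"
  using assms unfolding formation.simps(2) by (intro exI[of _ c] conjI)

lemma formation_drop: "formation (Suc s) B X l h \<Longrightarrow> formation s B X l h"
  by (auto intro: formation_mono)

lemma formation_antimono:
  assumes "formation s' B X l h" "s \<le> s'"
  shows "formation s B X l h"
  using assms(2,1) by (induction rule: dec_induct) (blast dest: formation_drop)+

lemma formation_prepend:
  assumes "formation s B X l h" "l' \<le> l" "\<forall>x\<in>X. \<exists>b\<in>B x. l' \<le> b \<and> b < l"
  shows "formation (Suc s) B X l' h"
  using assms
proof (induction s arbitrary: h)
  case 0
  then have "formation 0 B X l' l'" "l' \<le> h" "\<forall>x\<in>X. \<exists>b\<in>B x. l' \<le> b \<and> b < h"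
    by (auto, meson order.strict_trans2)
  then show ?case by auto
next
  case (Suc s)
  then show ?case by (subst formation.simps(2)) auto
qed

lemma formation_free_subset:
  assumes "formation_free r s A B l h" "A' \<subseteq> A" "l \<le> l'" "h' \<le> h"
  shows "formation_free r s A' B l' h'"
proof -
  have "formation s B X l h" if "formation s B X l' h'" for X
    by (rule formation_mono[OF that assms(3,4)]) auto
  then show ?thesis using assms(1,2) unfolding formation_free_def by blast
qed

lemma formation_free_mono:
  assumes "formation_free r s A B l h" "s \<le> s'"
  shows "formation_free r s' A B l h"
  using assms formation_antimono unfolding formation_free_def by blast

text \<open>A symbol that occurs on a further side of an interval can extend formations there, so the order
  of the forbidden formation drops inside the interval.\<close>

lemma formation_free_extend_right:
  assumes "formation_free r (Suc s) A B l h" "A' \<subseteq> A" "l \<le> l'" "h' \<le> h"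
    and "\<And>a. a \<in> A' \<Longrightarrow> \<exists>b\<in>B a. h' \<le> b \<and> b < h"
  shows "formation_free r s A' B l' h'"
  unfolding formation_free_def
proof (intro allI impI notI)
  fix X assume X: "X \<subseteq> A'" "card X = r" "formation s B X l' h'"
  have "formation s B X l h'" using X(3) assms(3) by (auto intro: formation_mono)
  then have "formation (Suc s) B X l h"
    using X(1) assms(4,5) by (intro formation_append) auto
  then show False using assms(1,2) X(1,2) unfolding formation_free_def by blast
qed

lemma formation_free_extend_left:
  assumes "formation_free r (Suc s) A B l h" "A' \<subseteq> A" "l \<le> l'" "h' \<le> h"
    and "\<And>a. a \<in> A' \<Longrightarrow> \<exists>b\<in>B a. l \<le> b \<and> b < l'"
  shows "formation_free r s A' B l' h'"
  unfolding formation_free_def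
proof (intro allI impI notI)
  fix X assume X: "X \<subseteq> A'" "card X = r" "formation s B X l' h'"
  have "formation s B X l' h" by (rule formation_mono[OF X(3) order_refl assms(4)]) auto
  then have "formation (Suc s) B X l h"
    using X(1) assms(3,5) by (intro formation_prepend) auto
  then show False using assms(1,2) X(1,2) unfolding formation_free_def by blast
qed

section \<open>Contraction of consecutive blocks\<close>

lemma mono_cuts:
  fixes \<kappa> :: "nat \<Rightarrow> nat"
  assumes "mono_on {l..<h} \<kappa>" "l \<le> h"
  obtains cut where "\<And>c. l \<le> cut c" "\<And>c. cut c \<le> h" "\<And>c d. c \<le> d \<Longrightarrow> cut c \<le> cut d"
    "\<And>c i. l \<le> i \<Longrightarrow> i < h \<Longrightarrow> i < cut c \<longleftrightarrow> \<kappa> i < c"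
proof
  \<comment> \<open>Admitting \<open>h\<close> as a value makes the minimum exist even when no block
    is mapped to \<open>c\<close> or above.\<close>
  define cut where "cut c = (LEAST i. i = h \<or> l \<le> i \<and> i < h \<and> c \<le> \<kappa> i)" for c
  have cut_spec: "cut c = h \<or> l \<le> cut c \<and> cut c < h \<and> c \<le> \<kappa> (cut c)" for c
    unfolding cut_def by (rule LeastI[of _ h]) simp
  have least: "cut c \<le> i" if "i = h \<or> l \<le> i \<and> i < h \<and> c \<le> \<kappa> i" for c i
    unfolding cut_def by (rule Least_le) (rule that)
  show "l \<le> cut c" "cut c \<le> h" for c using cut_spec[of c] assms(2) by auto
  show "cut c \<le> cut d" if "c \<le> d" for c d
    using cut_spec[of d] by (intro least) (use that in auto)
  show "i < cut c \<longleftrightarrow> \<kappa> i < c" if "l \<le> i" "i < h" for c i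
  proof
    assume "i < cut c"
    then show "\<kappa> i < c" using least[of i c] that by linarith
  next
    assume *: "\<kappa> i < c"
    show "i < cut c"
    proof (rule ccontr)
      assume "\<not> i < cut c"
      then have "cut c \<le> i" by simp
      with cut_spec[of c] that have "l \<le> cut c" "cut c < h" "c \<le> \<kappa> (cut c)" by auto
      moreover have "\<kappa> (cut c) \<le> \<kappa> i"
        using \<open>cut c \<le> i\<close> calculation that by (intro mono_onD[OF assms(1)]) auto
      ultimately show False using * by simp
    qed
  qed
qed

text \<open>The preimage of an initial segment under a monotone map is an initial segment, so the
  cuts of a formation among the merged blocks pull back to cuts among the original ones.\<close>

lemma formation_contract:
  assumes "formation s (\<lambda>x. \<kappa> ` (B x \<inter> {l..<h})) X c d" "mono_on {l..<h} \<kappa>" "l \<le> h"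
  shows "formation s B X l h"
proof -
  obtain cut where cut: "\<And>c. l \<le> cut c" "\<And>c. cut c \<le> h" "\<And>c d. c \<le> d \<Longrightarrow> cut c \<le> cut d"
    "\<And>c i. l \<le> i \<Longrightarrow> i < h \<Longrightarrow> i < cut c \<longleftrightarrow> \<kappa> i < c"
    by (rule mono_cuts[OF assms(2,3)]) (rule that)
  have "formation s B X l (cut d)"
    using assms(1)
  proof (induction s arbitrary: d)
    case 0
    then show ?case using cut(1) by simp
  next
    case (Suc s)
    from Suc.prems obtain e where e: "e \<le> d" "formation s (\<lambda>x. \<kappa> ` (B x \<inter> {l..<h})) X c e"
      "\<forall>x\<in>X. \<exists>b\<in>\<kappa> ` (B x \<inter> {l..<h}). e \<le> b \<and> b < d" by auto
    have "\<exists>b\<in>B x. cut e \<le> b \<and> b < cut d" if x: "x \<in> X" for x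
    proof -
      obtain b where "b \<in> B x" "l \<le> b" "b < h" "e \<le> \<kappa> b" "\<kappa> b < d"
        using e(3) x by fastforce
      then show ?thesis using cut(4)[of b e] cut(4)[of b d] by (intro bexI[of _ b]) auto
    qed
    then show ?case using Suc.IH[OF e(2)] cut(3)[OF e(1)] by (intro formation_append) auto
  qed
  show ?thesis by (rule formation_mono[OF \<open>formation s B X l (cut d)\<close> order_refl cut(2)]) auto
qed

section \<open>Counting symbols of formation-free block systems\<close>

lemma card_le_fibers:
  assumes "finite A" "\<And>a. a \<in> A \<Longrightarrow> f a \<in> {l..<h::nat}"
    and "\<And>c. c \<in> {l..<h} \<Longrightarrow> card {a \<in> A. f a = c} \<le> r"
  shows "card A \<le> r * (h - l)"
proof -
  have "card A \<le> card (\<Union>c\<in>{l..<h}. {a \<in> A. f a = c})"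
    using assms(1,2) by (intro card_mono) auto
  also have "\<dots> \<le> (\<Sum>c\<in>{l..<h}. card {a \<in> A. f a = c})" by (rule card_UN_le) simp
  also have "\<dots> \<le> (\<Sum>c\<in>{l..<h}. r)" using assms(3) by (intro sum_mono) auto
  finally show ?thesis by (simp add: mult.commute)
qed

lemma formation_free_card_le:
  assumes "finite A" "formation_free r s A B l h" "A' \<subseteq> A"
    and "\<And>X. X \<subseteq> A' \<Longrightarrow> formation s B X l h"
  shows "card A' \<le> r"
proof (rule ccontr)
  assume "\<not> card A' \<le> r"
  then obtain X where "X \<subseteq> A'" "card X = r"
    using obtain_subset_with_card_n[of r A'] by (metis nat_le_linear)
  then show False using assms unfolding formation_free_def by blast
qed

text \<open>Symbols with the same first block \<open>c\<close> occur up to \<open>c\<close> and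
  again after it, so \<open>r\<close> of them would form two permutations cut just behind
  \<open>c\<close>.\<close>

lemma symbols_le_two:
  assumes "finite A" "formation_free r 2 A B l h" "\<And>a. a \<in> A \<Longrightarrow> 1 < card (B a \<inter> {l..<h})"
  shows "card A \<le> r * (h - l)"
proof -
  define f where "f a = Min (B a \<inter> {l..<h})" for a
  have ne: "B a \<inter> {l..<h} \<noteq> {}" if "a \<in> A" for a using assms(3)[OF that] by force
  have f: "f a \<in> B a \<inter> {l..<h}" if "a \<in> A" for a
    unfolding f_def using ne[OF that] by (intro Min_in) auto
  have g: "\<exists>b\<in>B a. Suc (f a) \<le> b \<and> b < h" if "a \<in> A" for a
  proof (rule ccontr)
    assume *: "\<not> ?thesis"
    have "b = f a" if b: "b \<in> B a \<inter> {l..<h}" for b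
    proof -
      have "f a \<le> b" unfolding f_def using b by (intro Min_le) auto
      then show ?thesis using * b by fastforce
    qed
    then have "B a \<inter> {l..<h} \<subseteq> {f a}" by blast
    then have "card (B a \<inter> {l..<h}) \<le> 1" using card_mono[of "{f a}"] by fastforce
    then show False using assms(3)[OF that] by simp
  qed
  show ?thesis
  proof (rule card_le_fibers[OF assms(1), of f])
    show "card {a \<in> A. f a = c} \<le> r" if c: "c \<in> {l..<h}" for c
    proof (rule formation_free_card_le[OF assms(1,2)])
      show "formation 2 B X l h" if X: "X \<subseteq> {a \<in> A. f a = c}" for X
      proof -
        have "formation 1 B X l (Suc c)"
          using X f c by (auto intro!: exI[of _ l] bexI[of _ c])
        moreover have "\<forall>x\<in>X. \<exists>b\<in>B x. Suc c \<le> b \<and> b < h"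
          using X g by blast
        ultimately have "formation (Suc 1) B X l h"
          by (rule formation_append) (use c in simp)
        then show ?thesis by (simp only: numeral_2_eq_2 One_nat_def)
      qed
    qed simp
  qed (use f in auto)
qed

text \<open>A symbol with three occurrences has a block \<open>m\<close> with occurrences on both
  sides. Symbols that share \<open>m\<close> yield three permutations: before \<open>m\<close>, in
  \<open>m\<close> alone, and after \<open>m\<close>.\<close>

lemma symbols_le_three:
  assumes "finite A" "formation_free r 3 A B l h" "\<And>a. a \<in> A \<Longrightarrow> 2 < card (B a \<inter> {l..<h})"
  shows "card A \<le> r * (h - l)"
proof -
  have "\<exists>m\<in>B a. (\<exists>b\<in>B a. l \<le> b \<and> b < m) \<and> (\<exists>b\<in>B a. Suc m \<le> b \<and> b < h)"
    if a: "a \<in> A" for a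
  proof -
    obtain S where S: "S \<subseteq> B a \<inter> {l..<h}" "card S = 3"
      using obtain_subset_with_card_n[of 3 "B a \<inter> {l..<h}"] assms(3)[OF a]
      by (metis Suc_leI eval_nat_numeral(3))
    from S(2) obtain x y z where xyz: "S = {x, y, z}" "x \<noteq> y" "y \<noteq> z" "x \<noteq> z"
      by (auto simp: card_3_iff)
    have "x \<in> B a" "y \<in> B a" "z \<in> B a" "l \<le> x" "l \<le> y" "l \<le> z" "x < h" "y < h" "z < h"
      using S(1) unfolding xyz(1) by auto
    with xyz(2-4) show ?thesis unfolding Bex_def
      by (cases x y rule: linorder_cases; cases y z rule: linorder_cases; cases x z rule: linorder_cases)
        (auto simp: Suc_le_eq)
  qed
  then obtain f where f: "\<And>a. a \<in> A \<Longrightarrow> f a \<in> B a"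
    "\<And>a. a \<in> A \<Longrightarrow> \<exists>b\<in>B a. l \<le> b \<and> b < f a"
    "\<And>a. a \<in> A \<Longrightarrow> \<exists>b\<in>B a. Suc (f a) \<le> b \<and> b < h" by metis
  show ?thesis
  proof (rule card_le_fibers[OF assms(1), of f])
    show "card {a \<in> A. f a = c} \<le> r" if c: "c \<in> {l..<h}" for c
    proof (rule formation_free_card_le[OF assms(1,2)])
      show "formation 3 B X l h" if X: "X \<subseteq> {a \<in> A. f a = c}" for X
      proof -
        have "formation 1 B X l c"
          using X f(2) c by (auto intro!: exI[of _ l])
        moreover have "\<forall>x\<in>X. \<exists>b\<in>B x. c \<le> b \<and> b < Suc c"
          using X f(1) by blast
        ultimately have "formation (Suc 1) B X l (Suc c)" by (rule formation_append) simp
        moreover have "\<forall>x\<in>X. \<exists>b\<in>B x. Suc c \<le> b \<and> b < h"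
          using X f(3) by blast
        ultimately have "formation (Suc (Suc 1)) B X l h"
          by (rule formation_append) (use c in simp)
        then show ?thesis by (simp only: numeral_3_eq_3 One_nat_def)
      qed
    qed simp
  qed (use f in fastforce)+
qed

section \<open>Decomposition of the blocks into layers\<close>

lemma sum_layer_widths:
  fixes l h t :: nat
  shows "(\<Sum>j<n. min h (l + Suc j * t) - (l + j * t)) \<le> h - l"
proof -
  have "(\<Sum>j<n. min h (l + Suc j * t) - (l + j * t)) = min h (l + n * t) - l"
    by (induction n) (auto simp: min_def)
  then show ?thesis by simp
qed

text \<open>The blocks are grouped into \<open>n\<close> layers of at most \<open>t\<close> blocks. A symbol is counted by \<open>N0\<close> if
  it lives in one layer, by \<open>N1\<close> if it is frequent in its first or its last layer, by \<open>N2\<close> if it is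
  frequent in a layer between those, and otherwise it meets many layers and is counted by \<open>N3\<close> after
  contracting each layer to a block.\<close>

lemma card_symbols_by_layers:
  fixes A :: "'a set"
  assumes fin: "finite A" and free: "formation_free r (Suc (Suc s)) A B l h"
    and occ: "\<And>a. a \<in> A \<Longrightarrow> k < card (B a \<inter> {l..<h})"
    and k: "2 * k1 + k2 * (k3 - 2) \<le> k" and n: "h \<le> l + n * t" and t: "0 < t"
    and N0: "\<And>A' l' h'. A' \<subseteq> A \<Longrightarrow> l \<le> l' \<Longrightarrow> h' \<le> h \<Longrightarrow> h' - l' \<le> t \<Longrightarrow>
      formation_free r (Suc (Suc s)) A' B l' h' \<Longrightarrow>
      (\<And>a. a \<in> A' \<Longrightarrow> k < card (B a \<inter> {l'..<h'})) \<Longrightarrow> card A' \<le> N0 * (h' - l')"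
    and N1: "\<And>A' l' h'. A' \<subseteq> A \<Longrightarrow> l \<le> l' \<Longrightarrow> h' \<le> h \<Longrightarrow> h' - l' \<le> t \<Longrightarrow>
      formation_free r (Suc s) A' B l' h' \<Longrightarrow>
      (\<And>a. a \<in> A' \<Longrightarrow> k1 < card (B a \<inter> {l'..<h'})) \<Longrightarrow> card A' \<le> N1 * (h' - l')"
    and N2: "\<And>A' l' h'. A' \<subseteq> A \<Longrightarrow> l \<le> l' \<Longrightarrow> h' \<le> h \<Longrightarrow> h' - l' \<le> t \<Longrightarrow>
      formation_free r s A' B l' h' \<Longrightarrow>
      (\<And>a. a \<in> A' \<Longrightarrow> k2 < card (B a \<inter> {l'..<h'})) \<Longrightarrow> card A' \<le> N2 * (h' - l')"
    and N3: "\<And>A' B'. A' \<subseteq> A \<Longrightarrow> formation_free r (Suc (Suc s)) A' B' 0 n \<Longrightarrow>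
      (\<And>a. a \<in> A' \<Longrightarrow> k3 < card (B' a \<inter> {0..<n})) \<Longrightarrow> card A' \<le> N3"
  shows "card A \<le> (N0 + 2 * N1 + N2) * (h - l) + N3"
proof -
  define \<kappa> where "\<kappa> b = (b - l) div t" for b
  define lo where "lo j = l + j * t" for j
  \<comment> \<open>The last layer is cut off at \<open>h\<close>; layers beyond it are empty, so
    the widths still telescope to at most \<open>h - l\<close>.\<close>
  define hi where "hi j = min h (l + Suc j * t)" for j
  define lay where "lay j = {lo j..<hi j}" for j
  define B' where "B' a = \<kappa> ` (B a \<inter> {l..<h})" for a
  have lay: "b \<in> lay j \<longleftrightarrow> \<kappa> b = j" if "l \<le> b" "b < h" for b j
  proof -
    have "\<kappa> b = j \<longleftrightarrow> j * t \<le> b - l \<and> b - l < Suc j * t"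
      unfolding \<kappa>_def using t
      by (metis (no_types, lifting) div_less_iff_less_mult less_Suc_eq_le less_eq_div_iff_mult_less_eq
          order_antisym order_refl)
    then show ?thesis using that unfolding lay_def lo_def hi_def by auto
  qed
  have lay_sub: "lay j \<subseteq> {l..<h}" for j unfolding lay_def lo_def hi_def by auto
  have \<kappa>_n: "\<kappa> b < n" if "l \<le> b" "b < h" for b
    unfolding \<kappa>_def using that n t by (auto simp: div_less_iff_less_mult)
  have lh: "l \<le> h" if "A \<noteq> {}" using occ that
    by (metis all_not_in_conv atLeastLessThan_empty card.empty inf_bot_right nat_le_linear not_less_zero)
  have mono: "mono_on {l..<h} \<kappa>"
    unfolding \<kappa>_def by (intro mono_onI div_le_mono diff_le_mono)
  have finB': "finite (B' a)" for a unfolding B'_def by simp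
  have neB': "B' a \<noteq> {}" if "a \<in> A" for a unfolding B'_def using occ[OF that] by force
  have B'_n: "B' a \<subseteq> {0..<n}" for a unfolding B'_def using \<kappa>_n by auto
  have B'_mem: "\<exists>b\<in>B a. b \<in> lay j" if "j \<in> B' a" for a j
    using that lay unfolding B'_def by fastforce
  define f where "f a = Min (B' a)" for a
  define g where "g a = Max (B' a)" for a
  have f: "f a \<in> B' a" and g: "g a \<in> B' a" if "a \<in> A" for a
    unfolding f_def g_def using finB' neB'[OF that] by auto
  have fg: "f a \<le> j" "j \<le> g a" if "j \<in> B' a" for a j
    unfolding f_def g_def using finB' that by auto
  define Loc where "Loc j = {a \<in> A. B' a = {j}}" for j
  define Fst where "Fst j = {a \<in> A. f a = j \<and> j < g a \<and> k1 < card (B a \<inter> lay j)}" for j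
  define Lst where "Lst j = {a \<in> A. g a = j \<and> f a < j \<and> k1 < card (B a \<inter> lay j)}" for j
  define Mid where "Mid j = {a \<in> A. f a < j \<and> j < g a \<and> k2 < card (B a \<inter> lay j)}" for j
  define Glob where "Glob = {a \<in> A. k3 < card (B' a)}"
  define w where "w j = hi j - lo j" for j
  have lo: "l \<le> lo j" and hi: "hi j \<le> h" and w: "hi j - lo j \<le> t" for j
    unfolding lo_def hi_def by auto
  have after: "\<exists>b\<in>B a. hi j \<le> b \<and> b < h" if j: "a \<in> A" "j < g a" for a j
  proof -
    obtain b where b: "b \<in> B a" "b \<in> lay (g a)" using B'_mem[OF g[OF j(1)]] by blast
    have "hi j \<le> lo (g a)"
      using mult_le_mono1[of "Suc j" "g a" t] j(2) unfolding hi_def lo_def by simp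
    then show ?thesis using b hi[of "g a"] unfolding lay_def by (intro bexI[of _ b]) auto
  qed
  have before: "\<exists>b\<in>B a. l \<le> b \<and> b < lo j" if j: "a \<in> A" "f a < j" for a j
  proof -
    obtain b where b: "b \<in> B a" "b \<in> lay (f a)" using B'_mem[OF f[OF j(1)]] by blast
    have "hi (f a) \<le> lo j"
      using mult_le_mono1[of "Suc (f a)" "j" t] j(2) unfolding hi_def lo_def by simp
    then show ?thesis using b lo[of "f a"] unfolding lay_def by (intro bexI[of _ b]) auto
  qed
  have Loc: "card (Loc j) \<le> N0 * w j" for j
    unfolding w_def
  proof (rule N0[OF _ lo hi w])
    show "formation_free r (Suc (Suc s)) (Loc j) B (lo j) (hi j)"
      by (rule formation_free_subset[OF free _ lo hi]) (auto simp: Loc_def)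
    show "k < card (B a \<inter> {lo j..<hi j})" if "a \<in> Loc j" for a
    proof -
      have "\<kappa> b = j" if "b \<in> B a \<inter> {l..<h}" for b
        using \<open>a \<in> Loc j\<close> that unfolding Loc_def B'_def by auto
      then have "B a \<inter> {l..<h} \<subseteq> B a \<inter> lay j" using lay by auto
      then have "B a \<inter> {l..<h} = B a \<inter> lay j" using lay_sub by blast
      then show ?thesis using occ[of a] that unfolding Loc_def lay_def by simp
    qed
  qed (auto simp: Loc_def)
  have Fst: "card (Fst j) \<le> N1 * w j" for j
    unfolding w_def
  proof (rule N1[OF _ lo hi w])
    show "formation_free r (Suc s) (Fst j) B (lo j) (hi j)"
      by (rule formation_free_extend_right[OF free _ lo hi]) (auto simp: Fst_def intro: after)
  qed (auto simp: Fst_def lay_def)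
  have Lst: "card (Lst j) \<le> N1 * w j" for j
    unfolding w_def
  proof (rule N1[OF _ lo hi w])
    show "formation_free r (Suc s) (Lst j) B (lo j) (hi j)"
      by (rule formation_free_extend_left[OF free _ lo hi]) (auto simp: Lst_def intro: before)
  qed (auto simp: Lst_def lay_def)
  have Mid: "card (Mid j) \<le> N2 * w j" for j
    unfolding w_def
  proof (rule N2[OF _ lo hi w])
    \<comment> \<open>The left end stays at \<open>l\<close> while the right end is cut off, so that
      the occurrences before \<open>lo j\<close> remain available for removing a second
      permutation.\<close>
    have "formation_free r (Suc s) (Mid j) B l (hi j)"
      by (rule formation_free_extend_right[OF free _ order_refl hi]) (auto simp: Mid_def intro: after)
    then show "formation_free r s (Mid j) B (lo j) (hi j)"
      by (rule formation_free_extend_left[OF _ order_refl lo order_refl])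
        (auto simp: Mid_def intro: before)
  qed (auto simp: Mid_def lay_def)
  have Glob: "card Glob \<le> N3"
  proof (cases "Glob = {}")
    case False
    then have "l \<le> h" using lh unfolding Glob_def by auto
    show ?thesis
    proof (rule N3[of Glob B'])
      show "formation_free r (Suc (Suc s)) Glob B' 0 n"
        unfolding formation_free_def
      proof (intro allI impI notI)
        fix X assume X: "X \<subseteq> Glob" "card X = r" "formation (Suc (Suc s)) B' X 0 n"
        have "formation (Suc (Suc s)) B X l h"
          by (rule formation_contract[OF _ mono \<open>l \<le> h\<close>]) (use X(3) in \<open>simp only: B'_def[abs_def]\<close>)
        moreover have "X \<subseteq> A" using X(1) unfolding Glob_def by auto
        ultimately show False using free X(2) unfolding formation_free_def by blast
      qed
      show "k3 < card (B' a \<inter> {0..<n})" if "a \<in> Glob" for a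
        using that B'_n[of a] unfolding Glob_def by (auto simp: Int_absorb2)
    qed (auto simp: Glob_def)
  qed simp
  \<comment> \<open>A symbol in none of the classes meets at least two and at most \<open>k3\<close>
    layers, with at most \<open>k1\<close> occurrences in each of the two outer layers and at most
    \<open>k2\<close> in each other one. This is too few by the hypothesis on
    \<open>k\<close>.\<close>
  have cover: "A \<subseteq> (\<Union>j<n. Loc j \<union> Fst j \<union> Lst j \<union> Mid j) \<union> Glob"
  proof
    fix a assume a: "a \<in> A"
    show "a \<in> (\<Union>j<n. Loc j \<union> Fst j \<union> Lst j \<union> Mid j) \<union> Glob"
    proof (rule ccontr)
      assume "\<not> ?thesis"
      then have no: "a \<notin> Loc j" "a \<notin> Fst j" "a \<notin> Lst j" "a \<notin> Mid j" "a \<notin> Glob" if "j < n" for j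
        using that by auto
      have fn: "f a < n" and gn: "g a < n" using f[OF a] g[OF a] B'_n[of a] by auto
      have fg': "f a < g a"
      proof (rule ccontr)
        assume "\<not> f a < g a"
        then have "j = f a" if "j \<in> B' a" for j using fg[OF that] by auto
        then have "B' a = {f a}" using f[OF a] by blast
        then show False using no(1)[OF fn] a unfolding Loc_def by blast
      qed
      have c: "card (B a \<inter> lay (f a)) \<le> k1" "card (B a \<inter> lay (g a)) \<le> k1"
        using no(2)[OF fn] no(3)[OF gn] a fg' unfolding Fst_def Lst_def by auto
      have m: "card (B a \<inter> lay j) \<le> k2" if "j \<in> B' a - {f a, g a}" for j
      proof -
        have "f a < j" "j < g a" "j < n" using fg[of j a] that gn by auto
        then show ?thesis using no(4)[of j] a unfolding Mid_def by auto
      qed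
      have c3: "card (B' a - {f a, g a}) \<le> k3 - 2"
      proof -
        have "card (B' a - {f a, g a}) = card (B' a) - card {f a, g a}"
          using f[OF a] g[OF a] by (intro card_Diff_subset) auto
        then show ?thesis using no(5)[OF fn] a fg' unfolding Glob_def by auto
      qed
      have "B a \<inter> {l..<h} \<subseteq> (\<Union>j\<in>B' a. B a \<inter> lay j)"
        using lay unfolding B'_def by auto
      then have "card (B a \<inter> {l..<h}) \<le> card (\<Union>j\<in>B' a. B a \<inter> lay j)"
        using finB' by (intro card_mono) (auto simp: lay_def)
      also have "\<dots> \<le> (\<Sum>j\<in>B' a. card (B a \<inter> lay j))" by (rule card_UN_le[OF finB'])
      also have "\<dots> = (\<Sum>j\<in>{f a, g a}. card (B a \<inter> lay j)) + (\<Sum>j\<in>B' a - {f a, g a}. card (B a \<inter> lay j))"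
        using f[OF a] g[OF a] sum.subset_diff[OF _ finB', of "{f a, g a}" a "\<lambda>j. card (B a \<inter> lay j)"]
        by (simp only: add.commute) blast
      also have "\<dots> \<le> 2 * k1 + k2 * (k3 - 2)"
      proof (rule add_mono)
        show "(\<Sum>j\<in>{f a, g a}. card (B a \<inter> lay j)) \<le> 2 * k1" using c fg' by simp
        have "(\<Sum>j\<in>B' a - {f a, g a}. card (B a \<inter> lay j)) \<le> (\<Sum>j\<in>B' a - {f a, g a}. k2)"
          by (rule sum_mono) (rule m)
        also have "\<dots> \<le> k2 * (k3 - 2)" using c3 by simp
        finally show "(\<Sum>j\<in>B' a - {f a, g a}. card (B a \<inter> lay j)) \<le> k2 * (k3 - 2)" .
      qed
      finally show False using occ[OF a] k by simp
    qed
  qed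
  have finU: "finite (Loc j \<union> Fst j \<union> Lst j \<union> Mid j)" "finite Glob" for j
    using fin unfolding Loc_def Fst_def Lst_def Mid_def Glob_def by auto
  have "card A \<le> card ((\<Union>j<n. Loc j \<union> Fst j \<union> Lst j \<union> Mid j) \<union> Glob)"
    using cover finU by (intro card_mono) auto
  also have "\<dots> \<le> card (\<Union>j<n. Loc j \<union> Fst j \<union> Lst j \<union> Mid j) + card Glob" by (rule card_Un_le)
  also have "\<dots> \<le> (\<Sum>j<n. card (Loc j \<union> Fst j \<union> Lst j \<union> Mid j)) + N3"
    using Glob by (intro add_mono card_UN_le) auto
  also have "(\<Sum>j<n. card (Loc j \<union> Fst j \<union> Lst j \<union> Mid j)) \<le> (\<Sum>j<n. (N0 + 2 * N1 + N2) * w j)"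
  proof (rule sum_mono)
    fix j
    have "card (Loc j \<union> Fst j \<union> Lst j \<union> Mid j) \<le> card (Loc j) + card (Fst j) + card (Lst j) + card (Mid j)"
      by (meson card_Un_le add_le_mono1 order_trans)
    then show "card (Loc j \<union> Fst j \<union> Lst j \<union> Mid j) \<le> (N0 + 2 * N1 + N2) * w j"
      using Loc[of j] Fst[of j] Lst[of j] Mid[of j] by (simp add: algebra_simps)
  qed
  also have "\<dots> = (N0 + 2 * N1 + N2) * (\<Sum>j<n. w j)" by (simp add: sum_distrib_left)
  also have "\<dots> \<le> (N0 + 2 * N1 + N2) * (h - l)"
    using sum_layer_widths[of h l t n] unfolding w_def lo_def hi_def by (intro mult_le_mono2) simp
  finally show ?thesis by simp
qed

text \<open>Absorbs an increment of degree \<open>q - 1\<close> into a shift of the base; both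
  recursive symbol counts are closed this way.\<close>

lemma power_pred_add:
  fixes y :: nat
  assumes "1 \<le> q"
  shows "y ^ q + c * y ^ (q - 1) \<le> (y + c) ^ q"
proof -
  obtain p where q: "q = Suc p" using assms by (cases q) auto
  have "(y + c) * y ^ p \<le> (y + c) * (y + c) ^ p" by (intro mult_le_mono2 power_mono) auto
  then show ?thesis by (simp add: q algebra_simps)
qed

text \<open>Repeated halving of the blocks. Two layers have no layer between them, so the threshold
  only doubles with each order, at the price of a power of the logarithm. This is the base of the
  induction along the hierarchy.\<close>

lemma symbols_le_logarithmic:
  assumes "finite A" "formation_free r (v + 2) A B l h"
    and "\<And>a. a \<in> A \<Longrightarrow> 2 ^ v < card (B a \<inter> {l..<h})" "h - l \<le> 2 ^ L"
  shows "card A \<le> r * (2 * L + 1) ^ (v - 1) * (h - l)"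
  using assms
proof (induction v arbitrary: L A B l h)
  case 0
  then show ?case using symbols_le_two[of A r B l h] by (auto simp: numeral_2_eq_2)
next
  case (Suc v)
  note IHv = Suc.IH
  show ?case
  proof (cases v)
    case 0
    then show ?thesis using Suc.prems symbols_le_three[of A r B l h] by (auto simp: numeral_3_eq_3)
  next
    case (Suc w)
    note v = Suc
    show ?thesis using Suc.prems
    proof (induction L arbitrary: A B l h)
      case 0
      have "card (B a \<inter> {l..<h}) \<le> 1" for a
        using card_mono[of "{l..<h}" "B a \<inter> {l..<h}"] 0(4) by auto
      then have "A = {}" using 0(3) by (metis all_not_in_conv leD le_less_trans one_le_numeral one_le_power)
      then show ?case by simp
    next
      case (Suc L)
      \<comment> \<open>With two layers, \<open>k3 = 2\<close> empties the contracted class, as only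
        two blocks remain, and cancels the product in the condition on \<open>k\<close>. The choice
        \<open>k2 = 2 ^ L\<close> empties the middle class, as a layer has no more blocks than
        that.\<close>
      have "card A \<le> (r * (2 * L + 1) ^ v + 2 * (r * (2 * L + 1) ^ (v - 1)) + 0) * (h - l) + 0"
      proof (rule card_symbols_by_layers[where t = "2 ^ L" and n = 2 and k = "2 ^ Suc v"
            and ?k1.0 = "2 ^ v" and ?k2.0 = "2 ^ L" and ?k3.0 = 2 and s = "Suc v" and r = r and B = B])
        show "finite A" by fact
        show "formation_free r (Suc (Suc (Suc v))) A B l h" using Suc.prems(2) by simp
        show "\<And>a. a \<in> A \<Longrightarrow> 2 ^ Suc v < card (B a \<inter> {l..<h})" by fact
        show "h \<le> l + 2 * 2 ^ L" using Suc.prems(4) by simp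
      next
        fix A' l' h' assume *: "A' \<subseteq> A" "h' - l' \<le> 2 ^ L" "formation_free r (Suc (Suc (Suc v))) A' B l' h'"
          "\<And>a. a \<in> A' \<Longrightarrow> 2 ^ Suc v < card (B a \<inter> {l'..<h'})"
        have "finite A'" using *(1) Suc.prems(1) finite_subset by auto
        then show "card A' \<le> r * (2 * L + 1) ^ v * (h' - l')"
          using Suc.IH[of A' B l' h'] * by simp
      next
        fix A' l' h' assume *: "A' \<subseteq> A" "h' - l' \<le> 2 ^ L" "formation_free r (Suc (Suc v)) A' B l' h'"
          "\<And>a. a \<in> A' \<Longrightarrow> 2 ^ v < card (B a \<inter> {l'..<h'})"
        have "finite A'" using *(1) Suc.prems(1) finite_subset by auto
        then show "card A' \<le> r * (2 * L + 1) ^ (v - 1) * (h' - l')"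
          using IHv[of A' B l' h' L] * by simp
      next
        fix A' l' h' assume *: "A' \<subseteq> A" "h' - l' \<le> 2 ^ L"
          "\<And>a. a \<in> A' \<Longrightarrow> 2 ^ L < card (B a \<inter> {l'..<h'})"
        have "card (B a \<inter> {l'..<h'}) \<le> 2 ^ L" for a
          using card_mono[of "{l'..<h'}" "B a \<inter> {l'..<h'}"] *(2) by auto
        then have "A' = {}" using *(3) by (metis all_not_in_conv leD)
        then show "card A' \<le> 0 * (h' - l')" by simp
      next
        fix A' and B' :: "'a \<Rightarrow> nat set"
        assume *: "\<And>a. a \<in> A' \<Longrightarrow> 2 < card (B' a \<inter> {0..<2})"
        have "card (B' a \<inter> {0..<2}) \<le> 2" for a
          using card_mono[of "{0..<2}" "B' a \<inter> {0..<2}"] by auto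
        then have "A' = {}" using * by (metis all_not_in_conv leD)
        then show "card A' \<le> 0" by simp
      qed simp_all
      also have "\<dots> = r * ((2 * L + 1) ^ v + 2 * (2 * L + 1) ^ (v - 1)) * (h - l)"
        by (simp add: algebra_simps)
      also have "\<dots> \<le> r * ((2 * L + 1) + 2) ^ v * (h - l)"
        using v by (intro mult_le_mono1 mult_le_mono2 power_pred_add) simp
      finally show ?case by (simp add: algebra_simps)
    qed
  qed
qed

section \<open>The inverse Ackermann hierarchy\<close>

lemma ackinv_level_rec:
  "1 < k \<Longrightarrow> 1 < x \<Longrightarrow> ackinv_level k x = Suc (ackinv_level k (ackinv_level (k - 1) x))"
  by (subst ackinv_level.simps) simp

lemma ackinv_level_eq_0: "1 < k \<Longrightarrow> x \<le> 1 \<Longrightarrow> ackinv_level k x = 0"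
  by (subst ackinv_level.simps) simp

lemma ackinv_level_1: "k \<le> 1 \<Longrightarrow> ackinv_level k x = (x + 1) div 2"
  by (subst ackinv_level.simps) (simp, linarith)

lemma ackinv_level_less: "1 < x \<Longrightarrow> ackinv_level k x < x"
proof (induction k x rule: ackinv_level.induct)
  case (1 k x)
  show ?case
  proof (cases "k \<le> 1")
    case True
    then show ?thesis using 1(3) by (simp add: ackinv_level_1)
  next
    case False
    define y where "y = ackinv_level (k - 1) x"
    have y: "y < x" using 1(1) False 1(3) unfolding y_def by simp
    have "ackinv_level k y < x - 1"
    proof (cases "y \<le> 1")
      case True
      then show ?thesis using False 1(3) by (simp add: ackinv_level_eq_0)
    next
      case False
      then show ?thesis using 1(2) \<open>\<not> k \<le> 1\<close> 1(3) y unfolding y_def by force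
    qed
    then show ?thesis using False 1(3) by (simp add: ackinv_level_rec y_def)
  qed
qed

lemma ackinv_level_mono: "x \<le> x' \<Longrightarrow> ackinv_level k x \<le> ackinv_level k x'"
proof (induction k x arbitrary: x' rule: ackinv_level.induct)
  case (1 k x)
  show ?case
  proof (cases "k \<le> 1 \<or> x \<le> 1")
    case True
    then show ?thesis using 1(3)
      by (cases "k \<le> 1") (auto simp: ackinv_level_1 ackinv_level_eq_0)
  next
    case False
    then have "ackinv_level (k - 1) x \<le> ackinv_level (k - 1) x'" using 1(1)[of x'] 1(3) by simp
    then have "ackinv_level k (ackinv_level (k - 1) x) \<le> ackinv_level k (ackinv_level (k - 1) x')"
      using 1(2) False by simp
    then show ?thesis using False 1(3) by (simp add: ackinv_level_rec)
  qed
qed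

text \<open>The drop by 2 pays for the 1 added in the recursion: while \<alpha>_k(x) is at least 4,
  it gives \<alpha>_(k+1)(x) = 1 + \<alpha>_(k+1)(\<alpha>_k(x)), which is at most \<alpha>_k(x) -
  1.\<close>

lemma ackinv_level_le_diff:
  assumes "2 \<le> k" "4 \<le> x"
  shows "ackinv_level k x \<le> x - 2"
  using assms
proof (induction k arbitrary: x rule: dec_induct)
  case base
  have "ackinv_level 2 ((x + 1) div 2) \<le> (x + 1) div 2 - 1"
    using ackinv_level_less[of "(x + 1) div 2" 2] base by linarith
  then show ?case using base by (simp add: ackinv_level_rec ackinv_level_1)
next
  case (step k)
  define y where "y = ackinv_level k x"
  have y: "y \<le> x - 2" using step unfolding y_def by simp
  have "ackinv_level (Suc k) y \<le> x - 3"
  proof (cases "y \<le> 1")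
    case True
    then show ?thesis using step by (simp add: ackinv_level_eq_0)
  next
    case False
    then show ?thesis using ackinv_level_less[of y "Suc k"] y by linarith
  qed
  then show ?case using step by (simp add: ackinv_level_rec y_def)
qed

text \<open>If all levels stayed at 4 or more, each would lie strictly below the previous one, an
  infinite descent from \<alpha>_1(x).\<close>

lemma ackinv_exists: "\<exists>k \<ge> 1. ackinv_level k x \<le> 3"
proof (rule ccontr)
  assume "\<not> ?thesis"
  then have big: "4 \<le> ackinv_level k x" if "1 \<le> k" for k using that by force
  have "1 < x"
    using big[of 2] ackinv_level_eq_0[of 2 x] by (cases "x \<le> 1") auto
  have "ackinv_level (Suc k) x + k \<le> ackinv_level 1 x" for k
  proof (induction k)
    case (Suc k)
    have "ackinv_level (Suc (Suc k)) (ackinv_level (Suc k) x) \<le> ackinv_level (Suc k) x - 2"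
      using big by (intro ackinv_level_le_diff) auto
    then show ?case using Suc \<open>1 < x\<close> big[of "Suc k"] by (simp add: ackinv_level_rec[of "Suc (Suc k)"])
  qed simp
  then show False using big by (metis add_leD2 not_less_eq_eq)
qed

lemma ackinv_ge_1: "1 \<le> ackinv x" and ackinv_level_ackinv: "ackinv_level (ackinv x) x \<le> 3"
  using LeastI_ex[OF ackinv_exists[of x]] unfolding ackinv_def by auto

lemma ackinv_mono: "x \<le> y \<Longrightarrow> ackinv x \<le> ackinv y"
  unfolding ackinv_def[of x]
  using ackinv_ge_1 ackinv_level_ackinv[of y] ackinv_level_mono[of x y "ackinv y"]
  by (intro Least_le) auto

section \<open>Thresholds and the number of frequent symbols\<close>

text \<open>\<open>threshold v d\<close> goes with forbidden formations of order
  \<open>v + 2\<close> at level \<open>d\<close>. The recursion is the condition on \<open>k\<close>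
  in the layer decomposition, with the contracted blocks handled at level \<open>d - 1\<close>. The
  value 0 at level 0 makes level 1 equal to \<open>2 ^ v\<close>, the threshold of the halving
  argument.\<close>

fun threshold :: "nat \<Rightarrow> nat \<Rightarrow> nat" where
  "threshold 0 d = 1"
| "threshold (Suc 0) d = 2"
| "threshold (Suc (Suc v)) 0 = 0"
| "threshold (Suc (Suc v)) (Suc d) =
     2 * threshold (Suc v) (Suc d) + threshold v (Suc d) * threshold (Suc (Suc v)) d"

lemma threshold_ge: "1 \<le> d \<Longrightarrow> 2 ^ v \<le> threshold v d"
proof (induction v rule: induct_nat_012)
  case (ge2 v)
  then show ?case by (cases d) auto
qed auto

lemma threshold_pos: "1 \<le> d \<Longrightarrow> 0 < threshold v d"
  using threshold_ge[of d v] by (meson less_le_trans zero_less_numeral zero_less_power)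

lemma threshold_mono: "d \<le> d' \<Longrightarrow> threshold v d \<le> threshold v d'"
proof (induction d' rule: dec_induct)
  case (step d')
  have "threshold v d' \<le> threshold v (Suc d')"
  proof (cases "(v, d')" rule: threshold.cases)
    case (4 w e)
    show ?thesis using threshold_pos[of "Suc d'" w] 4 by (auto simp del: threshold.simps(4) simp: threshold.simps(4)[of w "Suc e"] trans_le_add2)
  qed auto
  then show ?case using step by simp
qed simp

text \<open>The offset 8 and the power \<open>p\<close> let the induction follow the recursion of \<open>\<alpha>\<^sub>d\<close>: layers of
  \<open>(\<alpha>\<^sub>d\<^sub>-\<^sub>1(x) + 8)^p\<close> blocks make the contracted symbols negligible and are of the form required
  for the induction hypothesis at \<open>\<alpha>\<^sub>d\<^sub>-\<^sub>1(x)\<close>.\<close>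

lemma symbols_le:
  assumes "1 \<le> d" "v \<le> p" "finite A" "formation_free r (v + 2) A B l h"
    and "\<And>a. a \<in> A \<Longrightarrow> threshold v d < card (B a \<inter> {l..<h})" "h - l \<le> (x + 8) ^ p"
  shows "card A \<le> r * (4 * p) ^ p * 4 ^ v * (ackinv_level d x + 8) ^ (v - 1) * (h - l)"
  using assms
proof (induction d x arbitrary: v A B l h rule: ackinv_level.induct)
  case (1 d x)
  note IH1 = "1.IH"(1) and IH2 = "1.IH"(2) and d = "1.prems"(1) and v = "1.prems"(2) and fin = "1.prems"(3)
    and free = "1.prems"(4) and thr = "1.prems"(5) and size = "1.prems"(6)
  define K where "K = r * (4 * p) ^ p"
  have p1: "1 \<le> (4 * p) ^ p" by (cases p) auto
  have low: ?case if "v \<le> 1" "card A \<le> r * (h - l)"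
  proof -
    have "r * (h - l) * 1 \<le> r * (h - l) * ((4 * p) ^ p * 4 ^ v)"
      using mult_le_mono[OF p1, of 1 "4 ^ v"] by (intro mult_le_mono2) simp
    then have "card A \<le> r * (h - l) * ((4 * p) ^ p * 4 ^ v)" using that(2) by linarith
    moreover have "v - 1 = 0" using that(1) by simp
    ultimately show ?thesis by (simp only: power_0 mult_1_right mult_ac)
  qed
  consider "v = 0" | "v = 1" | w where "v = Suc (Suc w)"
    by (metis One_nat_def not0_implies_Suc)
  then show ?case
  proof cases
    case 1
    then show ?thesis using symbols_le_two[of A r B l h] fin free thr
      by (intro low) (auto simp: numeral_2_eq_2)
  next
    case 2
    then show ?thesis using symbols_le_three[of A r B l h] fin free thr
      by (intro low) (auto simp: numeral_3_eq_3)
  next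
    case (3 w)
    show ?thesis
    proof (cases "d \<le> 1 \<or> x \<le> 1")
      case True
      \<comment> \<open>From \<open>x + 8 < 2 ^ (x + 8)\<close>: a logarithm linear in
        \<open>x\<close> is affordable, because here \<open>x\<close> is at most 1 or at most twice
        \<alpha>_1(x).\<close>
      define L where "L = (x + 8) * p"
      have "(x + 8) ^ p \<le> (2 ^ (x + 8)) ^ p" by (intro power_mono less_imp_le less_exp) simp
      then have "h - l \<le> 2 ^ L" using size unfolding L_def by (simp add: power_mult)
      then have "card A \<le> r * (2 * L + 1) ^ (v - 1) * (h - l)"
        using fin free thr threshold_ge[OF d, of v] by (intro symbols_le_logarithmic) (auto intro: le_less_trans)
      also have "\<dots> \<le> r * ((4 * p) ^ p * (ackinv_level d x + 8) ^ (v - 1)) * (h - l)"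
      proof (intro mult_le_mono1 mult_le_mono2)
        have "2 * L + 1 \<le> 4 * p * (ackinv_level d x + 8)"
        proof -
          have "x \<le> 1 \<or> x \<le> 2 * ackinv_level d x" using True by (auto simp: ackinv_level_1)
          then have "2 * (x + 8) + 1 \<le> 4 * (ackinv_level d x + 8)" by auto
          from mult_le_mono2[OF this, of p] v 3 show ?thesis unfolding L_def by (simp add: algebra_simps)
        qed
        then have "(2 * L + 1) ^ (v - 1) \<le> (4 * p) ^ (v - 1) * (ackinv_level d x + 8) ^ (v - 1)"
          by (metis power_mono power_mult_distrib zero_le)
        also have "(4 * p) ^ (v - 1) \<le> (4 * p) ^ p" using v 3 by (intro power_increasing) auto
        finally show "(2 * L + 1) ^ (v - 1) \<le> (4 * p) ^ p * (ackinv_level d x + 8) ^ (v - 1)" by simp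
      qed
      also have "\<dots> = r * ((4 * p) ^ p * 1 * (ackinv_level d x + 8) ^ (v - 1)) * (h - l)" by simp
      also have "\<dots> \<le> r * ((4 * p) ^ p * 4 ^ v * (ackinv_level d x + 8) ^ (v - 1)) * (h - l)"
        by (intro mult_le_mono1 mult_le_mono2) simp
      finally show ?thesis by (simp add: mult_ac)
    next
      case False
      define y where "y = ackinv_level (d - 1) x"
      define G where "G = ackinv_level d y + 8"
      define t where "t = (y + 8) ^ p"
      have level: "ackinv_level d x = Suc (ackinv_level d y)"
        using False unfolding y_def by (intro ackinv_level_rec) auto
      have IHy: "card A' \<le> K * 4 ^ u * G ^ (u - 1) * (h' - l')"
        if "u \<le> p" "A' \<subseteq> A" "formation_free r (u + 2) A' B' l' h'" "h' - l' \<le> t"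
          "\<And>a. a \<in> A' \<Longrightarrow> threshold u d < card (B' a \<inter> {l'..<h'})" for u A' B' l' h'
        unfolding K_def G_def y_def
        using that fin False d by (intro IH2) (auto simp: t_def y_def intro: finite_subset)
      show ?thesis
      proof (cases "h - l \<le> t")
        case True
        have "card A \<le> K * 4 ^ v * G ^ (v - 1) * (h - l)"
          using True v free thr by (intro IHy) auto
        also have "\<dots> \<le> K * 4 ^ v * Suc G ^ (v - 1) * (h - l)"
          by (intro mult_le_mono1 mult_le_mono2 power_mono) auto
        finally show ?thesis by (simp add: K_def G_def level)
      next
        case large: False
        define n where "n = (h - l) div t + 1"
        define m where "m = h - l"
        have "8 ^ 1 \<le> (y + 8) ^ 1" by simp
        also have "\<dots> \<le> t" unfolding t_def using v 3 by (intro power_increasing) auto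
        finally have t8: "8 \<le> t" by simp
        have nt1: "h - l \<le> n * t"
          using t8 mod_less_divisor[of t "h - l"] div_mult_mod_eq[of "h - l" t]
          unfolding n_def add_mult_distrib by linarith
        \<comment> \<open>Rounding the number of layers up costs at most a factor 2, since there are
          more than \<open>t\<close> blocks.\<close>
        have nt2: "n * t \<le> 2 * m"
          using large div_times_less_eq_dividend[of "h - l" t]
          unfolding n_def m_def add_mult_distrib by linarith
        have "n * 2 \<le> n * t" using t8 by (intro mult_le_mono2) simp
        then have nm: "n \<le> m" using nt2 by linarith
        \<comment> \<open>The width \<open>t\<close> is at least \<open>(y + 8) ^ v\<close>, one
          factor more than the count for contracted blocks has. That factor is at least 8; the
          rounding takes 2 of it and leaves 4.\<close>
        have N3: "4 * ((y + 8) ^ (v - 1) * n) \<le> m"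
        proof -
          have "8 * ((y + 8) ^ (v - 1) * n) \<le> (y + 8) * ((y + 8) ^ (v - 1) * n)" by (intro mult_le_mono1) simp
          also have "\<dots> = (y + 8) ^ v * n" by (simp add: 3)
          also have "\<dots> \<le> t * n" unfolding t_def using v by (intro mult_le_mono1 power_increasing) auto
          also have "\<dots> \<le> 2 * m" using nt2 by (simp add: mult.commute)
          finally show ?thesis by linarith
        qed
        have "card A \<le> (K * 4 ^ v * G ^ (v - 1) + 2 * (K * 4 ^ Suc w * G ^ w) + K * 4 ^ w * G ^ (w - 1)) * (h - l)
          + K * 4 ^ v * (y + 8) ^ (v - 1) * n"
        proof (rule card_symbols_by_layers[OF fin, where t = t and n = n and k = "threshold v d"
            and ?k1.0 = "threshold (Suc w) d" and ?k2.0 = "threshold w d" and ?k3.0 = "threshold v (d - 1)"])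
          show "formation_free r (Suc (Suc v)) A B l h" using free by simp
          show "2 * threshold (Suc w) d + threshold w d * (threshold v (d - 1) - 2) \<le> threshold v d"
            using d by (cases d) (auto simp: 3)
          show "h \<le> l + n * t" using nt1 by simp
          show "0 < t" using t8 by simp
        next
          fix A' l' h' assume "A' \<subseteq> A" "h' - l' \<le> t" "formation_free r (Suc (Suc v)) A' B l' h'"
            "\<And>a. a \<in> A' \<Longrightarrow> threshold v d < card (B a \<inter> {l'..<h'})"
          then show "card A' \<le> K * 4 ^ v * G ^ (v - 1) * (h' - l')" using v by (intro IHy) auto
        next
          fix A' l' h' assume "A' \<subseteq> A" "h' - l' \<le> t" "formation_free r (Suc v) A' B l' h'"
            "\<And>a. a \<in> A' \<Longrightarrow> threshold (Suc w) d < card (B a \<inter> {l'..<h'})"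
          then show "card A' \<le> K * 4 ^ Suc w * G ^ w * (h' - l')"
            using v IHy[of "Suc w" A' B l' h'] by (auto simp: 3)
        next
          fix A' l' h' assume "A' \<subseteq> A" "h' - l' \<le> t" "formation_free r v A' B l' h'"
            "\<And>a. a \<in> A' \<Longrightarrow> threshold w d < card (B a \<inter> {l'..<h'})"
          then show "card A' \<le> K * 4 ^ w * G ^ (w - 1) * (h' - l')"
            using v IHy[of w A' B l' h'] by (auto simp: 3)
        next
          fix A' and B' :: "'a \<Rightarrow> nat set"
          assume *: "A' \<subseteq> A" "formation_free r (Suc (Suc v)) A' B' 0 n"
            "\<And>a. a \<in> A' \<Longrightarrow> threshold v (d - 1) < card (B' a \<inter> {0..<n})"
          \<comment> \<open>The induction hypothesis at level \<open>d - 1\<close> is taken at the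
            same \<open>x\<close>: there are no more layers than blocks, so the size condition is
            inherited.\<close>
          have "card A' \<le> r * (4 * p) ^ p * 4 ^ v * (ackinv_level (d - 1) x + 8) ^ (v - 1) * (n - 0)"
            using * fin False v nm size by (intro IH1) (auto simp: m_def intro: finite_subset)
          then show "card A' \<le> K * 4 ^ v * (y + 8) ^ (v - 1) * n" by (simp add: K_def y_def)
        qed (rule thr)
        \<comment> \<open>In units of \<open>K * 4 ^ w\<close>, the increments over the leading term
          are \<open>8 * G ^ w\<close> from the first and last layers, at most \<open>G ^ w\<close>
          from the middle ones and \<open>4 * G ^ w\<close> from the contracted system. Since 13 is
          at most 16, the coefficient of the leading term, \<open>G\<close> grows by only 1,
          matching the recursion of \<alpha>_d; this is what the factor \<open>4 ^ v\<close> is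
          for.\<close>
        also have "\<dots> = (K * 4 ^ w) * (16 * G ^ Suc w + 8 * G ^ w + G ^ (w - 1)) * m
            + (K * 4 ^ w) * 4 * (4 * ((y + 8) ^ (v - 1) * n))"
          by (simp add: 3 m_def algebra_simps)
        also have "\<dots> \<le> (K * 4 ^ w) * (16 * G ^ Suc w + 8 * G ^ w + G ^ w) * m + (K * 4 ^ w) * 4 * (G ^ w * m)"
        proof (intro add_mono mult_le_mono1 mult_le_mono2 order_refl)
          show "G ^ (w - 1) \<le> G ^ w" unfolding G_def by (intro power_increasing) auto
          have "1 * m \<le> G ^ w * m" unfolding G_def by (intro mult_le_mono1) simp
          then show "4 * ((y + 8) ^ (v - 1) * n) \<le> G ^ w * m" using N3 by linarith
        qed
        also have "\<dots> = (K * 4 ^ w) * (16 * G ^ Suc w + 13 * G ^ w) * m" by (simp add: algebra_simps)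
        also have "\<dots> \<le> (K * 4 ^ w) * (16 * (G ^ Suc w + 1 * G ^ (Suc w - 1))) * m"
          by (intro mult_le_mono1 mult_le_mono2) simp
        also have "\<dots> \<le> (K * 4 ^ w) * (16 * (G + 1) ^ Suc w) * m"
          by (intro mult_le_mono1 mult_le_mono2 power_pred_add) simp
        finally show ?thesis by (simp add: 3 K_def G_def level m_def)
      qed
    qed
  qed
qed

section \<open>From symbols to lengths\<close>

lemma formation_image:
  assumes "formation s B X l h" "\<And>x. x \<in> X \<Longrightarrow> B x \<subseteq> B' (f x)"
  shows "formation s B' (f ` X) l h"
  using assms
proof (induction s arbitrary: h)
  case (Suc s)
  then obtain c where c: "c \<le> h" "formation s B X l c" "\<forall>x\<in>X. \<exists>b\<in>B x. c \<le> b \<and> b < h"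
    unfolding formation.simps(2) by blast
  have "formation s B' (f ` X) l c" using Suc.IH[OF c(2)] Suc.prems(2) by blast
  moreover have "\<forall>y\<in>f ` X. \<exists>b\<in>B' y. c \<le> b \<and> b < h" using c(3) Suc.prems(2) by blast
  ultimately show ?case using c(1) by (rule formation_append)
qed simp

text \<open>Cutting the occurrences of every symbol into chunks of \<open>k + 1\<close> consecutive ones, each regarded as
  a new symbol, creates no formation: two chunks of one symbol do not interleave.\<close>

lemma sum_card_le_by_chunks:
  fixes A :: "'a set"
  assumes fin: "finite A" and free: "formation_free r (Suc (Suc s)) A B l h"
    and sub: "\<And>a. a \<in> A \<Longrightarrow> B a \<subseteq> {l..<h}"
    and N: "\<And>(A' :: ('a \<times> nat) set) B'. finite A' \<Longrightarrow> formation_free r (Suc (Suc s)) A' B' l h \<Longrightarrow>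
      (\<And>a. a \<in> A' \<Longrightarrow> k < card (B' a \<inter> {l..<h})) \<Longrightarrow> card A' \<le> N"
  shows "(\<Sum>a\<in>A. card (B a)) \<le> k * card A + Suc k * N"
proof -
  define A' where "A' = (SIGMA a:A. {..<card (B a) div Suc k})"
  define e where "e a j = sorted_list_of_set (B a) ! j" for a j
  define B' where "B' = (\<lambda>(a, i). e a ` {i * Suc k..<Suc i * Suc k})"
  have finB: "finite (B a)" if "a \<in> A" for a using sub[OF that] by (rule finite_subset) simp
  have e_less: "e a i < e a j" if "a \<in> A" "i < j" "j < card (B a)" for a i j
    using sorted_wrt_nth_less[OF strict_sorted_list_of_set[of "B a"], of i j] that finB
    unfolding e_def by simp
  have e_mem: "e a j \<in> B a" if "a \<in> A" "j < card (B a)" for a j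
    using nth_mem[of j "sorted_list_of_set (B a)"] that finB unfolding e_def by simp
  have le: "j < card (B a)" if "(a, i) \<in> A'" "j < Suc i * Suc k" for a i j
  proof -
    have "Suc i \<le> card (B a) div Suc k" using that(1) unfolding A'_def by auto
    then have "Suc i * Suc k \<le> card (B a)" by (metis less_eq_div_iff_mult_less_eq zero_less_Suc)
    then show ?thesis using that(2) by linarith
  qed
  have inA: "a \<in> A" if "(a, i) \<in> A'" for a i using that unfolding A'_def by auto
  have B'_sub: "B' (a, i) \<subseteq> B a" if "(a, i) \<in> A'" for a i
    using e_mem[OF inA[OF that]] le[OF that] unfolding B'_def by auto
  have "card A' \<le> N"
  proof (rule N)
    show "finite A'" using fin unfolding A'_def by auto
    show "k < card (B' x \<inter> {l..<h})" if "x \<in> A'" for x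
    proof -
      obtain a i where x: "x = (a, i)" by (cases x)
      have "inj_on (e a) {i * Suc k..<Suc i * Suc k}"
      proof (rule linorder_inj_onI)
        fix m n assume "m < n" "m \<in> {i * Suc k..<Suc i * Suc k}" "n \<in> {i * Suc k..<Suc i * Suc k}"
        then show "e a m \<noteq> e a n"
          using e_less[of a m n] le[of a i n] inA[of a i] that x by auto
      qed auto
      then have "card (B' x) = Suc k" unfolding B'_def x by (simp add: card_image)
      moreover have "B' x \<subseteq> {l..<h}" using B'_sub[of a i] sub[OF inA] that x by blast
      ultimately show ?thesis by (simp add: Int_absorb2)
    qed
    show "formation_free r (Suc (Suc s)) A' B' l h"
      unfolding formation_free_def
    proof (intro allI impI notI)
      fix X assume X: "X \<subseteq> A'" "card X = r" "formation (Suc (Suc s)) B' X l h"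
      then obtain c where c: "formation (Suc s) B' X l c" "\<forall>x\<in>X. \<exists>b\<in>B' x. c \<le> b \<and> b < h"
        unfolding formation.simps(2)[of "Suc s"] by blast
      then have c1: "\<forall>x\<in>X. \<exists>b\<in>B' x. b < c"
        unfolding formation.simps(2) by blast
      \<comment> \<open>At the cut \<open>c\<close> before the last permutation, the later chunk
        \<open>j\<close> has an occurrence before \<open>c\<close> and the earlier chunk
        \<open>i\<close> one from \<open>c\<close> on, although all of chunk \<open>i\<close>
        precedes chunk \<open>j\<close>.\<close>
      have no: False if ij: "(a, i) \<in> X" "(a, j) \<in> X" "i < j" for a i j
      proof -
        obtain b1 where "b1 \<in> B' (a, j)" "b1 < c" using c1 ij(2) by blast
        then obtain m where m: "e a m < c" "j * Suc k \<le> m" "m < Suc j * Suc k" unfolding B'_def by auto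
        obtain b2 where "b2 \<in> B' (a, i)" "c \<le> b2" using c(2) ij(1) by blast
        then obtain n where n: "c \<le> e a n" "n < Suc i * Suc k" unfolding B'_def by auto
        have "Suc i * Suc k \<le> j * Suc k" using ij(3) by (intro mult_le_mono1) simp
        then have "n < m" using m(2) n(2) by linarith
        moreover have "m < card (B a)" "a \<in> A" using le[of a j m] m(3) inA[of a j] ij(2) X(1) by auto
        ultimately show False using e_less[of a n m] m(1) n(1) by simp
      qed
      have "inj_on fst X"
      proof (rule inj_onI)
        fix x y assume xy: "x \<in> X" "y \<in> X" "fst x = fst y"
        then have "\<not> snd x < snd y" "\<not> snd y < snd x"
          using no[of "fst x" "snd x" "snd y"] no[of "fst x" "snd y" "snd x"]
          by (metis prod.collapse)+
        then show "x = y" using xy by (auto simp: prod_eq_iff)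
      qed
      then have "card (fst ` X) = r" using X(2) by (simp add: card_image)
      moreover have "fst ` X \<subseteq> A" using X(1) inA by force
      moreover have "formation (Suc (Suc s)) B (fst ` X) l h"
        by (rule formation_image[OF X(3)]) (use X(1) B'_sub in force)
      ultimately show False using free unfolding formation_free_def by blast
    qed
  qed
  have "(\<Sum>a\<in>A. card (B a)) \<le> (\<Sum>a\<in>A. k + Suc k * (card (B a) div Suc k))"
  proof (rule sum_mono)
    fix a
    show "card (B a) \<le> k + Suc k * (card (B a) div Suc k)"
      using mult_div_mod_eq[of "Suc k" "card (B a)"] mod_less_divisor[of "Suc k" "card (B a)"] by linarith
  qed
  also have "\<dots> = k * card A + Suc k * card A'"
    using fin unfolding A'_def by (simp add: sum.distrib sum_distrib_left mult.commute)
  also have "\<dots> \<le> k * card A + Suc k * N"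
    using \<open>card A' \<le> N\<close> by (intro add_left_mono mult_le_mono2)
  finally show ?thesis .
qed

section \<open>Recovering lengths from first and last occurrences\<close>

definition sparse_on :: "nat \<Rightarrow> (nat \<Rightarrow> 'a) \<Rightarrow> nat \<Rightarrow> nat \<Rightarrow> bool" where
  "sparse_on r f l h \<longleftrightarrow> (\<forall>i j. l \<le> i \<and> i < j \<and> j < h \<and> j < i + r \<longrightarrow> f i \<noteq> f j)"

text \<open>Every position is a block of its own, so results on block systems apply directly.
  Functions on index intervals let pieces of a sequence be treated without reindexing.\<close>

definition seq_free :: "nat \<Rightarrow> nat \<Rightarrow> (nat \<Rightarrow> 'a) \<Rightarrow> nat \<Rightarrow> nat \<Rightarrow> bool" where
  "seq_free r s f l h \<longleftrightarrow> formation_free r s (f ` {l..<h}) (\<lambda>a. f -` {a}) l h"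

text \<open>Between consecutive first or last occurrences every symbol still occurs before and after, so two
  fewer permutations are available there; each such piece becomes one block.\<close>

lemma length_le_by_pieces:
  fixes f :: "nat \<Rightarrow> 'a"
  assumes free: "seq_free r (Suc (Suc s)) f l h"
    and n: "n = card (f ` {l..<h})"
    and short: "\<And>l' h'. l \<le> l' \<Longrightarrow> h' \<le> h \<Longrightarrow> seq_free r s f l' h' \<Longrightarrow>
      h' - l' \<le> \<phi> * card (f ` {l'..<h'})"
    and N: "\<And>(A' :: ('a \<times> nat) set) B'. finite A' \<Longrightarrow>
      formation_free r (Suc (Suc s)) A' B' 0 (2 * n + 1) \<Longrightarrow>
      (\<And>a. a \<in> A' \<Longrightarrow> k < card (B' a \<inter> {0..<2 * n + 1})) \<Longrightarrow> card A' \<le> N"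
  shows "h - l \<le> 2 * n + \<phi> * (k * n + Suc k * N)"
proof (cases "l \<le> h")
  case lh: True
  define S where "S = {l..<h}"
  define A where "A = f ` S"
  define Fi where "Fi = {i \<in> S. \<forall>j\<in>S. j < i \<longrightarrow> f j \<noteq> f i}"
  define La where "La = {i \<in> S. \<forall>j\<in>S. i < j \<longrightarrow> f j \<noteq> f i}"
  define P where "P = Fi \<union> La"
  \<comment> \<open>The at most \<open>2 * n\<close> positions in \<open>P\<close> cut the sequence
    into at most \<open>2 * n + 1\<close> pieces; \<kappa> numbers the pieces, \<open>J c\<close> is
    piece \<open>c\<close> without the cutting positions, and \<open>B a\<close> lists the pieces in
    which \<open>a\<close> occurs.\<close>
  define \<kappa> where "\<kappa> i = card {j \<in> P. j < i}" for i
  define J where "J c = {i \<in> S - P. \<kappa> i = c}" for c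
  define B where "B a = \<kappa> ` ((f -` {a} - P) \<inter> {l..<h})" for a
  have finP: "finite P" "P \<subseteq> S" unfolding P_def Fi_def La_def S_def by auto
  have finA: "finite A" unfolding A_def S_def by simp
  have cardP: "card P \<le> 2 * n"
  proof -
    have "inj_on f Fi" "inj_on f La"
      unfolding Fi_def La_def inj_on_def by (auto, (metis linorder_neqE_nat)+)
    moreover have "f ` Fi \<subseteq> A" "f ` La \<subseteq> A" unfolding A_def Fi_def La_def by auto
    ultimately have "card Fi \<le> n" "card La \<le> n"
      using card_inj_on_le[OF _ _ finA] n unfolding A_def S_def by auto
    then show ?thesis using card_Un_le[of Fi La] unfolding P_def by simp
  qed
  have \<kappa>_mono: "\<kappa> i \<le> \<kappa> j" if "i \<le> j" for i j
    unfolding \<kappa>_def using that finP by (intro card_mono) auto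
  have \<kappa>_less: "\<kappa> i < \<kappa> j" if "p \<in> P" "i \<le> p" "p < j" for i j p
  proof -
    have "p \<in> {m \<in> P. m < j}" "p \<notin> {m \<in> P. m < i}" using that by auto
    moreover have "{m \<in> P. m < i} \<subseteq> {m \<in> P. m < j}" using that by auto
    ultimately have "{m \<in> P. m < i} \<subset> {m \<in> P. m < j}" by blast
    then show ?thesis unfolding \<kappa>_def using finP by (intro psubset_card_mono) auto
  qed
  have \<kappa>_n: "\<kappa> i < 2 * n + 1" for i
  proof -
    have "\<kappa> i \<le> card P" unfolding \<kappa>_def using finP by (intro card_mono) auto
    then show ?thesis using cardP by simp
  qed
  have first: "\<exists>p\<in>P. f p = f i \<and> p \<le> i" if "i \<in> S" for i
  proof -
    define p where "p = Min {j \<in> S. f j = f i}"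
    have fin: "finite {j \<in> S. f j = f i}" unfolding S_def by simp
    have "p \<in> {j \<in> S. f j = f i}" unfolding p_def using that fin by (intro Min_in) auto
    moreover have "p \<le> j" if "j \<in> S" "f j = f i" for j
      unfolding p_def using that fin by (intro Min_le) auto
    ultimately show ?thesis using that unfolding P_def Fi_def
      by (intro bexI[of _ p]) (auto simp: not_less[symmetric])
  qed
  have last: "\<exists>p\<in>P. f p = f i \<and> i \<le> p" if "i \<in> S" for i
  proof -
    define p where "p = Max {j \<in> S. f j = f i}"
    have fin: "finite {j \<in> S. f j = f i}" unfolding S_def by simp
    have "p \<in> {j \<in> S. f j = f i}" unfolding p_def using that fin by (intro Max_in) auto
    moreover have "j \<le> p" if "j \<in> S" "f j = f i" for j
      unfolding p_def using that fin by (intro Max_ge) auto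
    ultimately show ?thesis using that unfolding P_def La_def
      by (intro bexI[of _ p]) (auto simp: not_less[symmetric])
  qed
  have piece: "card (J c) \<le> \<phi> * card (f ` J c)" for c
  proof (cases "J c = {}")
    case False
    define l' where "l' = Min (J c)"
    define h' where "h' = Suc (Max (J c))"
    have finJ: "finite (J c)" unfolding J_def S_def by simp
    have l': "l' \<in> J c" and h': "h' - 1 \<in> J c"
      unfolding l'_def h'_def using finJ False by auto
    have l_le: "l \<le> l'" and h_le: "h' \<le> h" using l' h' unfolding J_def S_def h'_def by auto
    have J_between: "j \<in> J c" if "i1 \<in> J c" "i2 \<in> J c" "i1 \<le> j" "j \<le> i2" for i1 i2 j
    proof -
      have "\<kappa> j = c" using \<kappa>_mono[OF that(3)] \<kappa>_mono[OF that(4)] that(1,2) unfolding J_def by auto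
      moreover have "j \<notin> P"
      proof
        assume "j \<in> P"
        then have "j < i2" using that(2,4) unfolding J_def by (cases "j = i2") auto
        then show False using \<kappa>_less[OF \<open>j \<in> P\<close> that(3), of i2] that(1,2) unfolding J_def by auto
      qed
      moreover have "j \<in> S" using that unfolding J_def S_def by auto
      ultimately show ?thesis unfolding J_def by simp
    qed
    have J_eq: "J c = {l'..<h'}"
    proof
      show "J c \<subseteq> {l'..<h'}" unfolding l'_def h'_def using finJ by (auto simp: less_Suc_eq_le)
      show "{l'..<h'} \<subseteq> J c" using J_between[OF l' h'] by auto
    qed
    have notP: "p \<notin> {l'..<h'}" if "p \<in> P" for p using that unfolding J_eq[symmetric] J_def by simp
    have sub: "{l'..<h'} \<subseteq> S" using l_le h_le unfolding S_def by auto
    have "formation_free r (Suc s) (f ` {l'..<h'}) (\<lambda>a. f -` {a}) l h'"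
    proof (rule formation_free_extend_right)
      show "formation_free r (Suc (Suc s)) (f ` {l..<h}) (\<lambda>a. f -` {a}) l h"
        using free unfolding seq_free_def .
      show "f ` {l'..<h'} \<subseteq> f ` {l..<h}" using sub unfolding S_def by blast
      fix a assume "a \<in> f ` {l'..<h'}"
      then obtain i where i: "i \<in> {l'..<h'}" "a = f i" by blast
      then obtain p where p: "p \<in> P" "f p = f i" "i \<le> p" using last sub by blast
      then have "h' \<le> p" using notP[OF p(1)] i(1) by auto
      then show "\<exists>b\<in>f -` {a}. h' \<le> b \<and> b < h"
        using p i finP(2) unfolding S_def by (intro bexI[of _ p]) auto
    qed (use h_le in auto)
    then have "formation_free r s (f ` {l'..<h'}) (\<lambda>a. f -` {a}) l' h'"
    proof (rule formation_free_extend_left)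
      fix a assume "a \<in> f ` {l'..<h'}"
      then obtain i where i: "i \<in> {l'..<h'}" "a = f i" by blast
      then obtain p where p: "p \<in> P" "f p = f i" "p \<le> i" using first sub by blast
      then have "p < l'" using notP[OF p(1)] i(1) by auto
      then show "\<exists>b\<in>f -` {a}. l \<le> b \<and> b < l'"
        using p i finP(2) unfolding S_def by (intro bexI[of _ p]) auto
    qed (use l_le in auto)
    then have "h' - l' \<le> \<phi> * card (f ` {l'..<h'})"
      using l_le h_le by (intro short) (auto simp: seq_free_def)
    then show ?thesis by (simp add: J_eq)
  qed simp
  have B_sub: "B a \<subseteq> {0..<2 * n + 1}" for a unfolding B_def using \<kappa>_n by auto
  have blocks: "(\<Sum>a\<in>A. card (B a)) \<le> k * card A + Suc k * N"
  proof (rule sum_card_le_by_chunks[OF finA _ B_sub N])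
    show "formation_free r (Suc (Suc s)) A B 0 (2 * n + 1)"
      unfolding formation_free_def
    proof (intro allI impI notI)
      fix X assume X: "X \<subseteq> A" "card X = r" "formation (Suc (Suc s)) B X 0 (2 * n + 1)"
      have "formation (Suc (Suc s)) (\<lambda>a. f -` {a} - P) X l h"
        by (rule formation_contract[OF _ _ lh])
          (use X(3) \<kappa>_mono in \<open>auto simp: B_def[abs_def] mono_on_def simp del: formation.simps\<close>)
      then have "formation (Suc (Suc s)) (\<lambda>a. f -` {a}) X l h"
        by (rule formation_mono) auto
      then show False using free X(1,2) unfolding seq_free_def formation_free_def A_def S_def by blast
    qed
  qed
  \<comment> \<open>Double counting of the pairs of a piece and a symbol in it: the sum of distinct
    symbols over the pieces becomes the total size of the block system.\<close>
  have swap: "(\<Sum>c<2 * n + 1. card (f ` J c)) = (\<Sum>a\<in>A. card (B a))"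
  proof -
    have "f ` J c = {a \<in> A. c \<in> B a}" for c
    proof (intro subset_antisym subsetI)
      fix a assume "a \<in> {a \<in> A. c \<in> B a}"
      then obtain i where "f i = a" "i \<notin> P" "i \<in> S" "\<kappa> i = c" unfolding B_def S_def by auto
      then show "a \<in> f ` J c" unfolding J_def by blast
    qed (auto simp: J_def A_def B_def S_def)
    then have "(\<Sum>c<2 * n + 1. card (f ` J c)) = (\<Sum>c<2 * n + 1. \<Sum>a\<in>{a \<in> A. c \<in> B a}. 1)" by simp
    also have "\<dots> = (\<Sum>a\<in>A. \<Sum>c\<in>{c \<in> {..<2 * n + 1}. c \<in> B a}. 1)"
      by (rule sum.swap_restrict) (auto simp: finA)
    also have "\<dots> = (\<Sum>a\<in>A. card (B a))"
    proof (rule sum.cong[OF refl])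
      fix a
      have "{c \<in> {..<2 * n + 1}. c \<in> B a} = B a" using B_sub[of a] by auto
      then show "(\<Sum>c\<in>{c \<in> {..<2 * n + 1}. c \<in> B a}. 1) = card (B a)" by simp
    qed
    finally show ?thesis .
  qed
  have "h - l \<le> card P + (\<Sum>c<2 * n + 1. card (J c))"
  proof -
    have "S \<subseteq> P \<union> (\<Union>c<2 * n + 1. J c)" unfolding J_def using \<kappa>_n by auto
    moreover have "finite (P \<union> (\<Union>c<2 * n + 1. J c))" using finP by (auto simp: J_def S_def)
    ultimately have "card S \<le> card (P \<union> (\<Union>c<2 * n + 1. J c))" by (intro card_mono)
    also have "\<dots> \<le> card P + card (\<Union>c<2 * n + 1. J c)" by (rule card_Un_le)
    also have "\<dots> \<le> card P + (\<Sum>c<2 * n + 1. card (J c))" by (intro add_left_mono card_UN_le) simp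
    finally show ?thesis by (simp add: S_def)
  qed
  moreover have "(\<Sum>c<2 * n + 1. card (J c)) \<le> \<phi> * (\<Sum>c<2 * n + 1. card (f ` J c))"
    unfolding sum_distrib_left by (intro sum_mono piece)
  ultimately have "h - l \<le> 2 * n + \<phi> * (\<Sum>a\<in>A. card (B a))"
    using cardP unfolding swap by linarith
  also have "\<dots> \<le> 2 * n + \<phi> * (k * card A + Suc k * N)"
    by (intro add_left_mono mult_le_mono2 blocks)
  finally show ?thesis unfolding n A_def S_def .
qed simp

text \<open>The length per symbol for forbidden order \<open>s\<close>, up to a constant. Pieces
  have order two less, and the block system of the pieces still has the full order, whose threshold
  has index two less than the order; hence the product.\<close>

fun excess :: "nat \<Rightarrow> nat \<Rightarrow> nat" where
  "excess 0 d = 1"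
| "excess (Suc 0) d = 1"
| "excess (Suc (Suc s)) d = excess s d * threshold s d"

lemma excess_pos: "1 \<le> d \<Longrightarrow> 0 < excess s d"
  by (induction s d rule: excess.induct) (auto simp: threshold_pos)

lemma excess_mono: "d \<le> d' \<Longrightarrow> excess s d \<le> excess s d'"
  by (induction s d rule: excess.induct) (auto intro: mult_le_mono threshold_mono)

lemma sparse_on_subset: "sparse_on r f l h \<Longrightarrow> l \<le> l' \<Longrightarrow> h' \<le> h \<Longrightarrow> sparse_on r f l' h'"
  unfolding sparse_on_def by force

text \<open>Any \<open>r\<close> consecutive entries are distinct and already form one permutation,
  so the length is below \<open>r\<close>.\<close>

lemma length_le_one:
  assumes "sparse_on r f l h" "seq_free r 1 f l h"
  shows "h - l \<le> r * card (f ` {l..<h})"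
proof (cases "l < h")
  case True
  have "h < l + r"
  proof (rule ccontr)
    assume "\<not> h < l + r"
    then have h: "l + r \<le> h" by simp
    have "inj_on f {l..<l + r}"
    proof (rule linorder_inj_onI)
      fix i j assume "i < j" "i \<in> {l..<l + r}" "j \<in> {l..<l + r}"
      then show "f i \<noteq> f j" using assms(1) h unfolding sparse_on_def by auto
    qed auto
    then have "card (f ` {l..<l + r}) = r" by (simp add: card_image)
    moreover have "f ` {l..<l + r} \<subseteq> f ` {l..<h}" using h by (intro image_mono) auto
    moreover have "formation 1 (\<lambda>a. f -` {a}) (f ` {l..<l + r}) l h"
      using h by (auto intro!: exI[of _ l])
    ultimately show False using assms(2) unfolding seq_free_def formation_free_def by blast
  qed
  moreover have "1 \<le> card (f ` {l..<h})" using True by (simp add: Suc_le_eq card_gt_0_iff)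
  then have "r * 1 \<le> r * card (f ` {l..<h})" by (intro mult_le_mono2)
  ultimately show ?thesis by linarith
qed simp

lemma length_le_step:
  assumes "1 \<le> s"
    and D: "\<And>(f :: nat \<Rightarrow> 'a) l h. sparse_on r f l h \<Longrightarrow> seq_free r s f l h \<Longrightarrow>
      h - l \<le> D * card (f ` {l..<h}) * excess s (ackinv (card (f ` {l..<h})))"
  shows "\<exists>D'. \<forall>(f :: nat \<Rightarrow> 'a) l h. sparse_on r f l h \<longrightarrow> seq_free r (Suc (Suc s)) f l h \<longrightarrow>
      h - l \<le> D' * card (f ` {l..<h}) * excess (Suc (Suc s)) (ackinv (card (f ` {l..<h})))"
proof -
  \<comment> \<open>The symbol count with \<open>p = s + 1\<close>, a power large enough for
    \<open>2 * n + 1\<close> blocks at \<open>x = n\<close>. At level \<alpha>(n) the base of the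
    last factor is at most 3 + 8 = 11.\<close>
  define C where "C = r * (4 * (s + 1)) ^ (s + 1) * 4 ^ s * 11 ^ (s - 1)"
  have "h - l \<le> (2 + D * (1 + 6 * C)) * card (f ` {l..<h}) * excess (Suc (Suc s)) (ackinv (card (f ` {l..<h})))"
    if sp: "sparse_on r f l h" and free: "seq_free r (Suc (Suc s)) f l h" for f :: "nat \<Rightarrow> 'a" and l h
  proof (cases "l < h")
    case True
    define n where "n = card (f ` {l..<h})"
    define d where "d = ackinv n"
    define e where "e = excess s d"
    define k where "k = threshold s d"
    have d1: "1 \<le> d" unfolding d_def by (rule ackinv_ge_1)
    have n1: "1 \<le> n" using True unfolding n_def by (simp add: Suc_le_eq card_gt_0_iff)
    have "h - l \<le> 2 * n + D * e * (k * n + Suc k * (C * (2 * n + 1)))"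
    proof (rule length_le_by_pieces[OF free n_def])
      fix l' h' assume *: "l \<le> l'" "h' \<le> h" "seq_free r s f l' h'"
      define n' where "n' = card (f ` {l'..<h'})"
      have "n' \<le> n" unfolding n_def n'_def using * by (intro card_mono image_mono) auto
      then have "excess s (ackinv n') \<le> e" unfolding e_def d_def by (intro excess_mono ackinv_mono)
      have "h' - l' \<le> D * n' * excess s (ackinv n')"
        unfolding n'_def using * sp by (intro D) (auto intro: sparse_on_subset)
      also have "\<dots> \<le> D * n' * e" by (intro mult_le_mono2) fact
      finally show "h' - l' \<le> D * e * card (f ` {l'..<h'})" by (simp add: n'_def mult_ac)
    next
      fix A' :: "('a \<times> nat) set" and B'
      assume *: "finite A'" "formation_free r (Suc (Suc s)) A' B' 0 (2 * n + 1)"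
        "\<And>a. a \<in> A' \<Longrightarrow> k < card (B' a \<inter> {0..<2 * n + 1})"
      have "2 * n + 1 \<le> (n + 8) ^ 2" by (simp add: power2_eq_square algebra_simps)
      also have "\<dots> \<le> (n + 8) ^ (s + 1)" using assms(1) by (intro power_increasing) auto
      finally have "card A' \<le> r * (4 * (s + 1)) ^ (s + 1) * 4 ^ s * (ackinv_level d n + 8) ^ (s - 1) * (2 * n + 1 - 0)"
        using * d1 by (intro symbols_le[where B = B']) (auto simp: k_def)
      also have "\<dots> \<le> r * (4 * (s + 1)) ^ (s + 1) * 4 ^ s * 11 ^ (s - 1) * (2 * n + 1 - 0)"
        using ackinv_level_ackinv[of n] unfolding d_def
        by (intro mult_le_mono1 mult_le_mono2 power_mono) auto
      finally show "card A' \<le> C * (2 * n + 1)" by (simp add: C_def)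
    qed
    \<comment> \<open>The 6 is 2 times 3, from \<open>Suc k \<le> 2 * k\<close> and
      \<open>2 * n + 1 \<le> 3 * n\<close>.\<close>
    also have "\<dots> \<le> (2 + D * (1 + 6 * C)) * n * (e * k)"
    proof -
      have e1: "1 \<le> e" and k1: "1 \<le> k"
        using excess_pos[OF d1] threshold_pos[OF d1] unfolding e_def k_def by (simp_all add: Suc_le_eq)
      have "2 * n * 1 \<le> 2 * n * (e * k)" using e1 k1 by (intro mult_le_mono2) (simp add: Suc_le_eq)
      moreover have "Suc k * (C * (2 * n + 1)) \<le> (2 * k) * (C * (3 * n))"
        using n1 k1 by (intro mult_le_mono mult_le_mono2) auto
      then have "D * e * (k * n + Suc k * (C * (2 * n + 1))) \<le> D * e * (k * n + (2 * k) * (C * (3 * n)))"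
        by (intro mult_le_mono2 add_left_mono)
      ultimately show ?thesis by (simp add: algebra_simps)
    qed
    finally show ?thesis by (simp add: n_def d_def e_def k_def)
  qed simp
  then show ?thesis by blast
qed

lemma length_le_excess:
  assumes "1 \<le> s"
  shows "\<exists>D. \<forall>(f :: nat \<Rightarrow> 'a) l h. sparse_on r f l h \<longrightarrow> seq_free r s f l h \<longrightarrow>
      h - l \<le> D * card (f ` {l..<h}) * excess s (ackinv (card (f ` {l..<h})))"
  using assms
proof (induction s rule: less_induct)
  case (less s)
  have one: "\<exists>D. \<forall>(f :: nat \<Rightarrow> 'a) l h. sparse_on r f l h \<longrightarrow> seq_free r 1 f l h \<longrightarrow>
      h - l \<le> D * card (f ` {l..<h}) * excess 1 (ackinv (card (f ` {l..<h})))"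
    using length_le_one[of r] by (intro exI[of _ r]) auto
  have step: "\<exists>D. \<forall>(f :: nat \<Rightarrow> 'a) l h. sparse_on r f l h \<longrightarrow> seq_free r (Suc (Suc s')) f l h \<longrightarrow>
      h - l \<le> D * card (f ` {l..<h}) * excess (Suc (Suc s')) (ackinv (card (f ` {l..<h})))"
    if "1 \<le> s'" and "\<exists>D. \<forall>(f :: nat \<Rightarrow> 'a) l h. sparse_on r f l h \<longrightarrow> seq_free r s' f l h \<longrightarrow>
      h - l \<le> D * card (f ` {l..<h}) * excess s' (ackinv (card (f ` {l..<h})))" for s'
    using that length_le_step[of s' r] by metis
  consider "s = 1" | "s = 2" | s' where "s = Suc (Suc s')" "1 \<le> s'"
    using less.prems by (metis One_nat_def Suc_1 Suc_le_mono le_0_eq le_SucE not0_implies_Suc not_less_eq_eq)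
  then show ?case
  proof cases
    \<comment> \<open>The step by two starts from order 1, so order 2 is read off from order 3,
      where \<open>excess\<close> is 2 instead of 1.\<close>
    case 2
    obtain D where D: "h - l \<le> D * card (f ` {l..<h}) * excess (Suc (Suc 1)) (ackinv (card (f ` {l..<h})))"
      if "sparse_on r f l h" "seq_free r (Suc (Suc 1)) f l h" for f :: "nat \<Rightarrow> 'a" and l h
      using step[OF order_refl one] by blast
    have "seq_free r (Suc (Suc 1)) f l h" if "seq_free r 2 f l h" for f :: "nat \<Rightarrow> 'a" and l h
      using that unfolding seq_free_def by (rule formation_free_mono) simp
    then have "h - l \<le> (2 * D) * card (f ` {l..<h}) * excess 2 (ackinv (card (f ` {l..<h})))"
      if "sparse_on r f l h" "seq_free r 2 f l h" for f :: "nat \<Rightarrow> 'a" and l h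
      using D[of f l h] that by (simp add: numeral_2_eq_2 algebra_simps)
    then show ?thesis unfolding 2 by blast
  next
    case (3 s')
    then show ?thesis using less.IH[of s'] step[of s'] by simp
  qed (use one in simp)
qed

section \<open>Growth of the thresholds\<close>

text \<open>The first two binomial terms with an explicit error. Writing \<open>x ^ u / x\<close>
  keeps the degree of the error correct even for \<open>u = 0\<close>.\<close>

lemma pred_power_le:
  fixes x :: real
  assumes "1 \<le> x"
  shows "(x - 1) ^ Suc u \<le> x ^ Suc u - (real u + 1) * x ^ u + (real u + 1)\<^sup>2 * (x ^ u / x)"
proof (induction u)
  case 0
  then show ?case using assms by simp
next
  case (Suc u)
  have "(x - 1) ^ Suc (Suc u) \<le>
      (x - 1) * (x ^ Suc u - (real u + 1) * x ^ u + (real u + 1)\<^sup>2 * (x ^ u / x))"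
    using Suc assms by (simp only: power_Suc[of _ "Suc u"]) (intro mult_left_mono, auto)
  also have "\<dots> = x ^ Suc (Suc u) - (real u + 2) * x ^ Suc u +
      ((real u + 1)\<^sup>2 + (real u + 1)) * x ^ u - (real u + 1)\<^sup>2 * (x ^ u / x)"
    using assms by (simp add: field_simps power2_eq_square)
  also have "\<dots> \<le> x ^ Suc (Suc u) - (real u + 2) * x ^ Suc u + (real u + 2)\<^sup>2 * x ^ u - 0"
    using assms by (intro diff_mono add_mono mult_right_mono) (auto simp: power2_eq_square algebra_simps)
  finally show ?case using assms by (simp add: algebra_simps)
qed

text \<open>The discrete derivative of the error term: a sufficiently large multiple of
  \<open>x ^ Suc u\<close> absorbs increments of order \<open>x ^ u\<close>.\<close>

lemma power_diff_ge:
  fixes x :: real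
  assumes "1 \<le> x"
  shows "x ^ u \<le> x ^ Suc u - (x - 1) ^ Suc u"
proof -
  have "(x - 1) * (x - 1) ^ u \<le> (x - 1) * x ^ u"
    using assms by (intro mult_left_mono power_mono) auto
  then show ?thesis by (simp add: algebra_simps)
qed

text \<open>The inequality \<open>ln y \<le> y - 1\<close> at \<open>y = x / M\<close>, together
  with \<open>ln 2 \<ge> 1 / 2\<close>. The free \<open>M\<close> makes the slope as small as
  desired.\<close>

lemma log2_le_linear:
  assumes "0 < x" "0 < M"
  shows "log 2 x \<le> 2 * (x / M) + log 2 (M :: real)"
proof -
  have "ln (exp (1 / 2)) \<le> ln (2 :: real)" using exp_half_le2 by (subst ln_le_cancel_iff) auto
  then have "1 * (x / M) \<le> (2 * ln 2) * (x / M)" using assms by (intro mult_right_mono) auto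
  moreover have "ln (x / M) \<le> x / M - 1" using assms by (intro ln_le_minus_one) simp
  ultimately have "ln (x / M) \<le> 2 * (x / M) * ln 2" by (simp only: mult_ac)
  then have "log 2 (x / M) \<le> 2 * (x / M)" by (simp add: log_def divide_le_eq)
  then show ?thesis using assms by (simp add: log_divide)
qed

lemma log2_le_self: "1 \<le> d \<Longrightarrow> log 2 (real d) \<le> real d"
  using less_exp[of d] by (intro less_imp_le log2_of_power_less) auto

text \<open>Both summands of the recursion are kept below half of \<open>2 powr e d\<close>, which
  turns it into additive conditions on the exponents.\<close>

lemma threshold_recursion_bound:
  fixes a b e :: "nat \<Rightarrow> real"
  assumes a: "\<And>d. 1 \<le> d \<Longrightarrow> real (threshold (Suc v) d) \<le> 2 powr a d"
    and b: "\<And>d. 1 \<le> d \<Longrightarrow> real (threshold v d) \<le> 2 powr b d"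
    and ae: "\<And>d. 1 \<le> d \<Longrightarrow> a d + 2 \<le> e d"
    and be: "\<And>d. 1 \<le> d \<Longrightarrow> b (Suc d) + e d + 1 \<le> e (Suc d)"
    and "1 \<le> d"
  shows "real (threshold (Suc (Suc v)) d) \<le> 2 powr e d"
  using \<open>1 \<le> d\<close>
proof (induction d rule: dec_induct)
  case base
  have "real (threshold (Suc (Suc v)) 1) = 2 * real (threshold (Suc v) 1)" by simp
  also have "\<dots> \<le> 2 powr (a 1 + 1)" using a[of 1] by (simp add: powr_add)
  also have "\<dots> \<le> 2 powr e 1" using ae[of 1] by (intro powr_mono) auto
  finally show ?case .
next
  case (step d)
  have "2 * real (threshold (Suc v) (Suc d)) \<le> 2 powr (a (Suc d) + 1)"
    using a[of "Suc d"] by (simp add: powr_add)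
  also have "\<dots> \<le> 2 powr (e (Suc d) - 1)" using ae[of "Suc d"] by (intro powr_mono) auto
  finally have 1: "2 * real (threshold (Suc v) (Suc d)) \<le> 2 powr (e (Suc d) - 1)" .
  have "real (threshold v (Suc d)) * real (threshold (Suc (Suc v)) d) \<le> 2 powr b (Suc d) * 2 powr e d"
    using step b[of "Suc d"] by (intro mult_mono) auto
  also have "\<dots> \<le> 2 powr (e (Suc d) - 1)"
    using be[OF step(1)] by (simp add: powr_add[symmetric])
  finally have 2: "real (threshold v (Suc d)) * real (threshold (Suc (Suc v)) d) \<le> 2 powr (e (Suc d) - 1)" .
  have "2 powr (e (Suc d) - 1) + 2 powr (e (Suc d) - 1) = 2 powr e (Suc d)"
    by (simp add: powr_diff)
  then show ?case using 1 2 by simp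
qed

lemma threshold_2: "threshold (Suc (Suc 0)) d = 4 * d"
  by (induction d) auto

text \<open>The recursion reads T(d+1) = 2 T(d) + 8 (d+1); the linear terms on the left make the
  induction close.\<close>

lemma threshold_3: "threshold (Suc (Suc (Suc 0))) d + 8 * d + 16 \<le> 16 * 2 ^ d"
  by (induction d) (auto simp: threshold_2)

text \<open>The exponent at order index v is in essence the sum over d of that at v - 2. Both
  parities go in one induction because index v - 1 must also stay below the new exponent.\<close>

lemma threshold_bounds:
  "\<exists>c\<ge>0. \<forall>d\<ge>1. real (threshold (2 * t + 2) d) \<le>
     2 powr (real d ^ t * log 2 (real d) / fact t + c * real d ^ t)"
  "\<exists>c\<ge>0. \<forall>d\<ge>1. real (threshold (2 * t + 3) d) \<le>
     2 powr (real d ^ Suc t / fact (Suc t) + c * real d ^ t)"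
proof (induction t)
  case 0
  {
    case 1
    have "real (4 * d) = 2 powr (log 2 (real d) + 2)" if "1 \<le> d" for d
      using that by (simp add: powr_add)
    then show ?case by (intro exI[of _ 2]) (simp add: threshold_2 numeral_2_eq_2)
  next
    case 2
    have "real (threshold 3 d) \<le> 2 powr (real d + 4)" for d
    proof -
      have "threshold 3 d \<le> 16 * 2 ^ d" using threshold_3[of d] by (simp add: numeral_3_eq_3)
      then have "real (threshold 3 d) \<le> real (16 * 2 ^ d)" by (rule of_nat_mono)
      also have "\<dots> = 2 powr (real d + 4)" by (simp add: powr_add powr_realpow)
      finally show ?thesis .
    qed
    then show ?case by (intro exI[of _ 4]) simp
  }
next
  case (Suc t)
  define u where "u = real t + 1"
  have fact_u: "fact (Suc t) = u * fact t" unfolding u_def by simp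
  have fact1: "1 \<le> (fact k :: real)" for k by (rule fact_ge_1)
  obtain c1 where c1: "c1 \<ge> 0" "\<And>d. 1 \<le> d \<Longrightarrow> real (threshold (2 * t + 2) d) \<le>
     2 powr (real d ^ t * log 2 (real d) / fact t + c1 * real d ^ t)" using Suc.IH(1) by blast
  obtain c2 where c2: "c2 \<ge> 0" "\<And>d. 1 \<le> d \<Longrightarrow> real (threshold (2 * t + 3) d) \<le>
     2 powr (real d ^ Suc t / fact (Suc t) + c2 * real d ^ t)" using Suc.IH(2) by blast
  have even: "\<exists>c\<ge>0. \<forall>d\<ge>1. real (threshold (2 * Suc t + 2) d) \<le>
     2 powr (real d ^ Suc t * log 2 (real d) / fact (Suc t) + c * real d ^ Suc t)"
  proof -
    \<comment> \<open>The part \<open>3 + c2\<close> covers the preceding index and the 2 added to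
      it; \<open>c1 + u\<^sup>2\<close> with one more unit covers the increment from
      \<open>d\<close> to \<open>Suc d\<close>.\<close>
    define c where "c = 3 + c2 + c1 + u\<^sup>2"
    have "real (threshold (Suc (Suc (2 * t + 2))) d) \<le>
        2 powr (real d ^ Suc t * log 2 (real d) / fact (Suc t) + c * real d ^ Suc t)" if "1 \<le> d" for d
    proof (rule threshold_recursion_bound[OF _ c1(2) _ _ that])
      fix d :: nat assume d: "1 \<le> d"
      show "real (threshold (Suc (2 * t + 2)) d) \<le> 2 powr (real d ^ Suc t / fact (Suc t) + c2 * real d ^ t)"
        using c2(2)[OF d] by (simp add: numeral_3_eq_3)
      have "real d ^ Suc t / fact (Suc t) \<le> real d ^ Suc t / 1"
        by (intro divide_left_mono fact1) auto
      moreover have "c2 * real d ^ t \<le> c2 * real d ^ Suc t"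
        using d c2(1) by (intro mult_left_mono power_increasing) auto
      moreover have "1 \<le> real d ^ Suc t" using d by (intro one_le_power) simp
      moreover have "0 \<le> real d ^ Suc t * log 2 (real d) / fact (Suc t)" using d by simp
      moreover have "0 \<le> (c1 + u\<^sup>2) * real d ^ Suc t" using c1(1) by simp
      ultimately show "real d ^ Suc t / fact (Suc t) + c2 * real d ^ t + 2 \<le>
          real d ^ Suc t * log 2 (real d) / fact (Suc t) + c * real d ^ Suc t"
        unfolding c_def distrib_right by linarith
    next
      fix d :: nat assume d: "1 \<le> d"
      define x where "x = real (Suc d)"
      have x: "1 \<le> x" "real d = x - 1" "log 2 (x - 1) \<le> log 2 x" "0 \<le> log 2 x"
        using d unfolding x_def by auto
      have lx: "log 2 x \<le> x" unfolding x_def by (intro log2_le_self) simp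
      have "(x - 1) ^ Suc t * log 2 (x - 1) \<le> (x - 1) ^ Suc t * log 2 x"
        using x by (intro mult_left_mono) auto
      also have "\<dots> \<le> (x ^ Suc t - u * x ^ t + u\<^sup>2 * (x ^ t / x)) * log 2 x"
        using pred_power_le[OF x(1), of t] x unfolding u_def by (intro mult_right_mono) (auto simp: add.commute)
      also have "\<dots> = x ^ Suc t * log 2 x - u * x ^ t * log 2 x + u\<^sup>2 * x ^ t * (log 2 x / x)"
        by (simp add: algebra_simps)
      also have "\<dots> \<le> x ^ Suc t * log 2 x - u * x ^ t * log 2 x + u\<^sup>2 * x ^ t * 1"
        using lx x by (intro add_left_mono mult_left_mono) auto
      finally have "(x - 1) ^ Suc t * log 2 (x - 1) / fact (Suc t) \<le>
          (x ^ Suc t * log 2 x - u * x ^ t * log 2 x + u\<^sup>2 * x ^ t) / fact (Suc t)"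
        by (intro divide_right_mono) auto
      also have "\<dots> = x ^ Suc t * log 2 x / fact (Suc t) - x ^ t * log 2 x / fact t + u\<^sup>2 * x ^ t / fact (Suc t)"
        unfolding fact_u u_def by (simp add: divide_simps)
      also have "\<dots> \<le> x ^ Suc t * log 2 x / fact (Suc t) - x ^ t * log 2 x / fact t + u\<^sup>2 * x ^ t / 1"
        using x by (intro add_left_mono divide_left_mono fact1) auto
      finally have main: "x ^ t * log 2 x / fact t + (x - 1) ^ Suc t * log 2 (x - 1) / fact (Suc t) \<le>
          x ^ Suc t * log 2 x / fact (Suc t) + u\<^sup>2 * x ^ t" by simp
      have "c * x ^ t \<le> c * (x ^ Suc t - (x - 1) ^ Suc t)"
        using power_diff_ge[OF x(1), of t] c1(1) c2(1) unfolding c_def by (intro mult_left_mono) auto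
      moreover have "1 \<le> x ^ t" "0 \<le> c2 * x ^ t" using x c2(1) by (auto intro: one_le_power)
      ultimately have "c1 * x ^ t + u\<^sup>2 * x ^ t + 1 + c * (x - 1) ^ Suc t \<le> c * x ^ Suc t"
        unfolding c_def distrib_right right_diff_distrib by linarith
      then show "real (Suc d) ^ t * log 2 (real (Suc d)) / fact t + c1 * real (Suc d) ^ t +
          (real d ^ Suc t * log 2 (real d) / fact (Suc t) + c * real d ^ Suc t) + 1 \<le>
          real (Suc d) ^ Suc t * log 2 (real (Suc d)) / fact (Suc t) + c * real (Suc d) ^ Suc t"
        using main unfolding x(2) x_def[symmetric] by linarith
    qed
    moreover have "0 \<le> c" using c1(1) c2(1) unfolding c_def by simp
    ultimately show ?thesis by (intro exI[of _ c]) auto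
  qed
  {
    case 1
    show ?case by (rule even)
  next
    case 2
    obtain c3 where c3: "c3 \<ge> 0" "\<And>d. 1 \<le> d \<Longrightarrow> real (threshold (2 * Suc t + 2) d) \<le>
      2 powr (real d ^ Suc t * log 2 (real d) / fact (Suc t) + c3 * real d ^ Suc t)" using even by blast
    define w where "w = real (Suc t) + 1"
    have w: "1 \<le> w" and fact_w: "fact (Suc (Suc t)) = w * fact (Suc t)" unfolding w_def by simp_all
    \<comment> \<open>\<open>K\<close> is the constant in \<open>log 2 d \<le> d / w + K\<close>.
      With slope \<open>1 / w\<close>, the logarithmic exponent of the preceding index fits exactly
      under the new leading term, because the new factorial is \<open>w\<close> times the old
      one.\<close>
    define K where "K = log 2 (2 * w)"
    have K: "0 \<le> K" unfolding K_def using w by simp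
    define c where "c = 3 + c3 + c2 + K + w\<^sup>2"
    have "real (threshold (Suc (Suc (2 * t + 3))) d) \<le>
        2 powr (real d ^ Suc (Suc t) / fact (Suc (Suc t)) + c * real d ^ Suc t)" if "1 \<le> d" for d
    proof (rule threshold_recursion_bound[OF _ c2(2) _ _ that])
      fix d :: nat assume d: "1 \<le> d"
      show "real (threshold (Suc (2 * t + 3)) d) \<le>
          2 powr (real d ^ Suc t * log 2 (real d) / fact (Suc t) + c3 * real d ^ Suc t)"
        using c3(2)[OF d] by (simp add: eval_nat_numeral)
      have "log 2 (real d) \<le> real d / w + K"
        using log2_le_linear[of "real d" "2 * w"] d w unfolding K_def by (simp add: field_simps)
      then have "real d ^ Suc t * log 2 (real d) / fact (Suc t) \<le> real d ^ Suc t * (real d / w + K) / fact (Suc t)"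
        by (intro divide_right_mono mult_left_mono) auto
      also have "\<dots> = real d ^ Suc (Suc t) / fact (Suc (Suc t)) + K * real d ^ Suc t / fact (Suc t)"
        unfolding fact_w using w by (simp add: field_simps del: fact_Suc)
      also have "\<dots> \<le> real d ^ Suc (Suc t) / fact (Suc (Suc t)) + K * real d ^ Suc t / 1"
        using K by (intro add_left_mono divide_left_mono fact1) auto
      finally have "real d ^ Suc t * log 2 (real d) / fact (Suc t) \<le>
        real d ^ Suc (Suc t) / fact (Suc (Suc t)) + K * real d ^ Suc t" by simp
      moreover have "1 \<le> real d ^ Suc t" using d by (intro one_le_power) simp
      moreover have "0 \<le> (c2 + w\<^sup>2) * real d ^ Suc t" using c2(1) by simp
      ultimately show "real d ^ Suc t * log 2 (real d) / fact (Suc t) + c3 * real d ^ Suc t + 2 \<le>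
          real d ^ Suc (Suc t) / fact (Suc (Suc t)) + c * real d ^ Suc t"
        unfolding c_def distrib_right by linarith
    next
      fix d :: nat assume d: "1 \<le> d"
      define x where "x = real (Suc d)"
      have x: "1 \<le> x" "real d = x - 1" using d unfolding x_def by auto
      have "(x - 1) ^ Suc (Suc t) / fact (Suc (Suc t)) \<le>
          (x ^ Suc (Suc t) - w * x ^ Suc t + w\<^sup>2 * x ^ t) / fact (Suc (Suc t))"
        using pred_power_le[OF x(1), of "Suc t"] x unfolding w_def
        by (intro divide_right_mono) (auto simp: add.commute)
      also have "\<dots> = x ^ Suc (Suc t) / fact (Suc (Suc t)) - x ^ Suc t / fact (Suc t) + w\<^sup>2 * x ^ t / fact (Suc (Suc t))"
        unfolding fact_w using w by (simp add: field_simps del: fact_Suc)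
      also have "\<dots> \<le> x ^ Suc (Suc t) / fact (Suc (Suc t)) - x ^ Suc t / fact (Suc t) + w\<^sup>2 * x ^ t / 1"
        using x by (intro add_left_mono divide_left_mono fact1) auto
      finally have main: "x ^ Suc t / fact (Suc t) + (x - 1) ^ Suc (Suc t) / fact (Suc (Suc t)) \<le>
          x ^ Suc (Suc t) / fact (Suc (Suc t)) + w\<^sup>2 * x ^ t" by simp
      have "c * x ^ t \<le> c * (x ^ Suc t - (x - 1) ^ Suc t)"
        using power_diff_ge[OF x(1), of t] c3(1) c2(1) K unfolding c_def by (intro mult_left_mono) auto
      moreover have "1 \<le> x ^ t" "0 \<le> (c3 + K) * x ^ t" using x c3(1) K by (auto intro: one_le_power)
      ultimately have "c2 * x ^ t + w\<^sup>2 * x ^ t + 1 + c * (x - 1) ^ Suc t \<le> c * x ^ Suc t"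
        unfolding c_def distrib_right right_diff_distrib by linarith
      then show "real (Suc d) ^ Suc t / fact (Suc t) + c2 * real (Suc d) ^ t +
          (real d ^ Suc (Suc t) / fact (Suc (Suc t)) + c * real d ^ Suc t) + 1 \<le>
          real (Suc d) ^ Suc (Suc t) / fact (Suc (Suc t)) + c * real (Suc d) ^ Suc t"
        using main unfolding x(2) x_def[symmetric] by linarith
    qed
    moreover have "0 \<le> c" using c3(1) c2(1) K unfolding c_def by simp
    ultimately show ?case by (intro exI[of _ c]) (auto simp: eval_nat_numeral)
  }
qed

text \<open>The exponent of the earlier factors is at most a multiple of \<open>d ^ Suc t\<close> by
  \<open>log 2 d \<le> d\<close>, so it falls into the error term and the newest threshold alone
  sets the leading term.\<close>

lemma excess_even_bound:
  "\<exists>c\<ge>0. \<forall>d\<ge>1. real (excess (2 * t + 4) d) \<le>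
     2 powr (real d ^ t * log 2 (real d) / fact t + c * real d ^ t)"
proof (induction t)
  case 0
  have "excess 4 d = threshold 2 d" for d by (simp add: eval_nat_numeral)
  then show ?case using threshold_bounds(1)[of 0] by (simp add: numeral_2_eq_2)
next
  case (Suc t)
  obtain c1 where c1: "c1 \<ge> 0" "\<And>d. 1 \<le> d \<Longrightarrow> real (excess (2 * t + 4) d) \<le>
     2 powr (real d ^ t * log 2 (real d) / fact t + c1 * real d ^ t)" using Suc.IH by blast
  obtain c2 where c2: "c2 \<ge> 0" "\<And>d. 1 \<le> d \<Longrightarrow> real (threshold (2 * Suc t + 2) d) \<le>
     2 powr (real d ^ Suc t * log 2 (real d) / fact (Suc t) + c2 * real d ^ Suc t)"
    using threshold_bounds(1)[of "Suc t"] by blast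
  have "real (excess (2 * Suc t + 4) d) \<le>
     2 powr (real d ^ Suc t * log 2 (real d) / fact (Suc t) + (1 + c1 + c2) * real d ^ Suc t)"
    if d: "1 \<le> d" for d
  proof -
    have "real (excess (2 * Suc t + 4) d) = real (excess (2 * t + 4) d) * real (threshold (2 * Suc t + 2) d)"
      by (simp add: eval_nat_numeral)
    also have "\<dots> \<le> 2 powr (real d ^ t * log 2 (real d) / fact t + c1 * real d ^ t) *
      2 powr (real d ^ Suc t * log 2 (real d) / fact (Suc t) + c2 * real d ^ Suc t)"
      using c1(2)[OF d] c2(2)[OF d] by (intro mult_mono) auto
    also have "\<dots> = 2 powr (real d ^ t * log 2 (real d) / fact t + c1 * real d ^ t +
      (real d ^ Suc t * log 2 (real d) / fact (Suc t) + c2 * real d ^ Suc t))"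
      by (simp add: powr_add)
    also have "\<dots> \<le> 2 powr (real d ^ Suc t * log 2 (real d) / fact (Suc t) + (1 + c1 + c2) * real d ^ Suc t)"
    proof (intro powr_mono)
      have "real d ^ t * log 2 (real d) / fact t \<le> real d ^ t * real d / 1"
        using log2_le_self[OF d] d by (intro frac_le mult_left_mono) (auto simp: fact_ge_1)
      moreover have "c1 * real d ^ t \<le> c1 * real d ^ Suc t"
        using d c1(1) by (intro mult_left_mono power_increasing) auto
      ultimately show "real d ^ t * log 2 (real d) / fact t + c1 * real d ^ t +
        (real d ^ Suc t * log 2 (real d) / fact (Suc t) + c2 * real d ^ Suc t) \<le>
        real d ^ Suc t * log 2 (real d) / fact (Suc t) + (1 + c1 + c2) * real d ^ Suc t"
        by (simp add: algebra_simps)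
    qed simp
    finally show ?thesis .
  qed
  then show ?case using c1(1) c2(1) by (intro exI[of _ "1 + c1 + c2"]) auto
qed

lemma excess_odd_bound:
  "\<exists>c\<ge>0. \<forall>d\<ge>1. real (excess (2 * t + 5) d) \<le>
     2 powr (real d ^ Suc t / fact (Suc t) + c * real d ^ t)"
proof (induction t)
  case 0
  obtain c where c: "c \<ge> 0" "\<And>d. 1 \<le> d \<Longrightarrow> real (threshold 3 d) \<le> 2 powr (real d + c)"
    using threshold_bounds(2)[of 0] by auto
  have "real (excess 5 d) \<le> 2 powr (real d + (1 + c))" if "1 \<le> d" for d
  proof -
    have "excess 5 d = 2 * threshold 3 d" by (simp add: eval_nat_numeral)
    then show ?thesis using c(2)[OF that] by (simp add: powr_add)
  qed
  then show ?case using c(1) by (intro exI[of _ "1 + c"]) simp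
next
  case (Suc t)
  obtain c1 where c1: "c1 \<ge> 0" "\<And>d. 1 \<le> d \<Longrightarrow> real (excess (2 * t + 5) d) \<le>
     2 powr (real d ^ Suc t / fact (Suc t) + c1 * real d ^ t)" using Suc.IH by blast
  obtain c2 where c2: "c2 \<ge> 0" "\<And>d. 1 \<le> d \<Longrightarrow> real (threshold (2 * Suc t + 3) d) \<le>
     2 powr (real d ^ Suc (Suc t) / fact (Suc (Suc t)) + c2 * real d ^ Suc t)"
    using threshold_bounds(2)[of "Suc t"] by blast
  have "real (excess (2 * Suc t + 5) d) \<le>
     2 powr (real d ^ Suc (Suc t) / fact (Suc (Suc t)) + (1 + c1 + c2) * real d ^ Suc t)"
    if d: "1 \<le> d" for d
  proof -
    have "real (excess (2 * Suc t + 5) d) = real (excess (2 * t + 5) d) * real (threshold (2 * Suc t + 3) d)"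
      by (simp add: eval_nat_numeral)
    also have "\<dots> \<le> 2 powr (real d ^ Suc t / fact (Suc t) + c1 * real d ^ t) *
      2 powr (real d ^ Suc (Suc t) / fact (Suc (Suc t)) + c2 * real d ^ Suc t)"
      using c1(2)[OF d] c2(2)[OF d] by (intro mult_mono) auto
    also have "\<dots> = 2 powr (real d ^ Suc t / fact (Suc t) + c1 * real d ^ t +
      (real d ^ Suc (Suc t) / fact (Suc (Suc t)) + c2 * real d ^ Suc t))"
      by (simp add: powr_add)
    also have "\<dots> \<le> 2 powr (real d ^ Suc (Suc t) / fact (Suc (Suc t)) + (1 + c1 + c2) * real d ^ Suc t)"
    proof (intro powr_mono)
      have "real d ^ Suc t / fact (Suc t) \<le> real d ^ Suc t / 1"
        by (intro divide_left_mono fact_ge_1) auto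
      moreover have "c1 * real d ^ t \<le> c1 * real d ^ Suc t"
        using d c1(1) by (intro mult_left_mono power_increasing) auto
      ultimately show "real d ^ Suc t / fact (Suc t) + c1 * real d ^ t +
        (real d ^ Suc (Suc t) / fact (Suc (Suc t)) + c2 * real d ^ Suc t) \<le>
        real d ^ Suc (Suc t) / fact (Suc (Suc t)) + (1 + c1 + c2) * real d ^ Suc t"
        unfolding distrib_right by linarith
    qed simp
    finally show ?thesis .
  qed
  then show ?case using c1(1) c2(1) by (intro exI[of _ "1 + c1 + c2"]) auto
qed

section \<open>Formations contain every sequence\<close>

text \<open>Take the shortest prefix of \<open>ys\<close> that covers \<open>X\<close>; its last
  entry is \<open>c\<close>.\<close>

lemma prefix_up_to_last_new_symbol:
  assumes "X \<subseteq> set ys" "X \<noteq> {}"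
  shows "\<exists>P c Q. ys = P @ c # Q \<and> c \<in> X \<and> X - {c} \<subseteq> set P"
  using assms
proof (induction ys rule: rev_induct)
  case (snoc y ys)
  show ?case
  proof (cases "X \<subseteq> set ys")
    case True
    then obtain P c Q where "ys = P @ c # Q" "c \<in> X" "X - {c} \<subseteq> set P" using snoc by blast
    then show ?thesis by (intro exI[of _ P] exI[of _ c] exI[of _ "Q @ [y]"]) simp
  next
    case False
    then have "y \<in> X" "X - {y} \<subseteq> set ys" using snoc.prems by auto
    then show ?thesis by (intro exI[of _ ys] exI[of _ y] exI[of _ "[]"]) simp
  qed
qed simp

text \<open>The letters of \<open>u\<close> are placed from the right: a letter occurring earlier in \<open>u\<close> uses up the last
  permutation, and a new letter is sent to the symbol completing the last permutation.\<close>

lemma embed_in_formation: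
  assumes "finite X" "card X = card (set u)" "length segs = Suc (length u - card (set u))"
    and "\<forall>seg\<in>set segs. X \<subseteq> set seg"
  shows "\<exists>f. inj_on f (set u) \<and> f ` set u \<subseteq> X \<and> subseq (map f u) (concat segs)"
  using assms
proof (induction u arbitrary: X segs rule: rev_induct)
  case (snoc a u)
  obtain segs' seg where segs: "segs = segs' @ [seg]"
    using snoc.prems(3) by (metis length_0_conv nat.distinct(1) rev_exhaust)
  show ?case
  proof (cases "a \<in> set u")
    case True
    then have set_eq: "set (u @ [a]) = set u" by auto
    have "card (set u) \<le> length u" by (rule card_length)
    then have len: "length segs' = Suc (length u - card (set u))"
      using snoc.prems(3) unfolding set_eq segs by simp
    obtain f where f: "inj_on f (set u)" "f ` set u \<subseteq> X" "subseq (map f u) (concat segs')"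
      using snoc.IH[of X segs'] snoc.prems len unfolding set_eq segs by auto
    have "f a \<in> set seg" using f(2) True snoc.prems(4) segs by auto
    then have "subseq [f a] seg" by (simp add: subseq_singleton_left)
    then have "subseq (map f (u @ [a])) (concat segs)"
      using list_emb_append_mono[OF f(3)] unfolding segs by simp
    then show ?thesis using f(1,2) unfolding set_eq by blast
  next
    case False
    have X_ne: "X \<noteq> {}" using snoc.prems(2) by auto
    obtain P c Q where P: "seg = P @ c # Q" "c \<in> X" "X - {c} \<subseteq> set P"
      using prefix_up_to_last_new_symbol[OF _ X_ne, of seg] snoc.prems(4) segs by auto
    have card_X: "card (X - {c}) = card (set u)" using snoc.prems(1,2) P(2) False by simp
    \<comment> \<open>Truncated to \<open>P\<close>, the last segment still covers the remaining
      symbols. The number of segments stays right, since length and number of symbols of the word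
      both drop by one.\<close>
    have sub: "\<forall>seg'\<in>set (segs' @ [P]). X - {c} \<subseteq> set seg'"
      using snoc.prems(4) P(3) unfolding segs by auto
    obtain f where f: "inj_on f (set u)" "f ` set u \<subseteq> X - {c}" "subseq (map f u) (concat (segs' @ [P]))"
      using snoc.IH[of "X - {c}" "segs' @ [P]"] snoc.prems(1,3) card_X sub False unfolding segs by auto
    define g where "g = f(a := c)"
    have map_g: "map g (u @ [a]) = map f u @ [c]" using False unfolding g_def by simp
    have "subseq (map f u @ [c]) (concat (segs' @ [P]) @ c # Q)"
      by (rule list_emb_append_mono[OF f(3)]) (simp add: subseq_singleton_left)
    then have "subseq (map g (u @ [a])) (concat segs)" unfolding map_g segs P(1) by simp
    moreover have "inj_on g (set (u @ [a]))" "g ` set (u @ [a]) \<subseteq> X"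
      using f(1,2) P(2) False unfolding g_def inj_on_def by auto
    ultimately show ?thesis by blast
  qed
qed simp

lemma formation_segments:
  assumes "formation s (\<lambda>x. (!) S -` {x}) X l h" "h \<le> length S"
  shows "\<exists>segs. length segs = s \<and> (\<forall>seg\<in>set segs. X \<subseteq> set seg) \<and> subseq (concat segs) (take h S)"
  using assms
proof (induction s arbitrary: h)
  case (Suc s)
  from Suc.prems(1) obtain c where c: "c \<le> h" "formation s (\<lambda>x. (!) S -` {x}) X l c"
    "\<forall>x\<in>X. \<exists>b\<in>(!) S -` {x}. c \<le> b \<and> b < h" unfolding formation.simps(2) by blast
  obtain segs where segs: "length segs = s" "\<forall>seg\<in>set segs. X \<subseteq> set seg"
    "subseq (concat segs) (take c S)"
    using Suc.IH[OF c(2)] c(1) Suc.prems(2) by auto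
  define seg where "seg = drop c (take h S)"
  have "X \<subseteq> set seg"
  proof
    fix x assume "x \<in> X"
    then obtain b where b: "S ! b = x" "c \<le> b" "b < h" using c(3) by auto
    then have "seg ! (b - c) = x" "b - c < length seg" using Suc.prems(2) unfolding seg_def by auto
    then show "x \<in> set seg" using nth_mem by blast
  qed
  moreover have "take h S = take c S @ seg"
    unfolding seg_def using c(1) append_take_drop_id[of c "take h S"] by (simp add: min_absorb1)
  then have "subseq (concat (segs @ [seg])) (take h S)"
    using list_emb_append_mono[OF segs(3), of seg seg] by simp
  ultimately show ?case using segs(1,2) by (intro exI[of _ "segs @ [seg]"]) auto
qed simp

lemma contains_if_formation:
  assumes "formation (length u - num_symbols u + 1) (\<lambda>x. (!) S -` {x}) X 0 (length S)"
    and "finite X" "card X = num_symbols u"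
  shows "contains S u"
proof -
  obtain segs where segs: "length segs = length u - num_symbols u + 1" "\<forall>seg\<in>set segs. X \<subseteq> set seg"
    "subseq (concat segs) S"
    using formation_segments[OF assms(1) order_refl] by auto
  obtain f where f: "inj_on f (set u)" "subseq (map f u) (concat segs)"
    using embed_in_formation[of X u segs] assms(2,3) segs(1,2) unfolding num_symbols_def by auto
  \<comment> \<open>\<open>contains\<close> renames the subsequence to \<open>u\<close>, so the
    embedding of \<open>u\<close> has to be inverted.\<close>
  define g where "g = inv_into (set u) f"
  have "inj_on g (set (map f u))" unfolding g_def by (simp add: inj_on_inv_into)
  moreover have "map g (map f u) = u"
    using f(1) unfolding g_def by (simp add: map_idI)
  moreover have "subseq (map f u) S" using f(2) segs(3) by (rule subseq_order.trans)
  ultimately show ?thesis unfolding contains_def by blast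
qed

section \<open>Bounds for the extremal function\<close>

lemma ex_len_le_excess:
  fixes r s :: nat
  assumes "r + 3 \<le> s"
  obtains D :: nat where "\<And>n (u :: 'a list). num_symbols u = r \<Longrightarrow> length u = s \<Longrightarrow>
    ereal_of_enat (ex_len u n) \<le> ereal (real n * (real D * real (excess (s - r + 1) (ackinv n))))"
proof -
  \<comment> \<open>\<open>D\<close> is fixed before \<open>u\<close> and \<open>n\<close>, so the
    constants depend on \<open>r\<close> and \<open>s\<close> only.\<close>
  obtain D where D: "h - l \<le> D * card (f ` {l..<h}) * excess (s - r + 1) (ackinv (card (f ` {l..<h})))"
    if "sparse_on r f l h" "seq_free r (s - r + 1) f l h" for f :: "nat \<Rightarrow> nat" and l h
    using length_le_excess[of "s - r + 1" r] by auto
  have "ereal_of_enat (ex_len u n) \<le> ereal (real n * (real D * real (excess (s - r + 1) (ackinv n))))"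
    if u: "num_symbols u = r" "length u = s" for u :: "'a list" and n
  proof -
    have "length S \<le> D * n * excess (s - r + 1) (ackinv n)" if S: "S \<in> free_seqs u n" for S
    proof -
      have img: "(!) S ` {0..<length S} = set S" by (auto simp: set_conv_nth)
      have cardS: "card (set S) = n" "sparse r S" "\<not> contains S u"
        using S u(1) unfolding free_seqs_def num_symbols_def by auto
      have "sparse_on r ((!) S) 0 (length S)"
        unfolding sparse_on_def
      proof (intro allI impI)
        fix i j assume ij: "0 \<le> i \<and> i < j \<and> j < length S \<and> j < i + r"
        then have "1 \<le> \<bar>int i - int j\<bar>" "\<bar>int i - int j\<bar> \<le> int r - 1" by auto
        then show "S ! i \<noteq> S ! j" using cardS(2) ij unfolding sparse_def by auto
      qed
      moreover have "seq_free r (s - r + 1) ((!) S) 0 (length S)"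
        unfolding seq_free_def formation_free_def img
      proof (intro allI impI notI)
        fix X assume "X \<subseteq> set S" "card X = r" "formation (s - r + 1) (\<lambda>a. (!) S -` {a}) X 0 (length S)"
        then have "contains S u"
          using u by (intro contains_if_formation[of u S X]) (auto intro: finite_subset)
        then show False using cardS(3) by simp
      qed
      ultimately show ?thesis using D[of "(!) S" 0 "length S"] unfolding img cardS(1) by simp
    qed
    then have "ex_len u n \<le> enat (D * n * excess (s - r + 1) (ackinv n))"
      unfolding ex_len_def by (intro SUP_least) simp
    then have "ereal_of_enat (ex_len u n) \<le> ereal_of_enat (enat (D * n * excess (s - r + 1) (ackinv n)))"
      by (simp only: ereal_of_enat_le_iff)
    then show ?thesis by (simp add: mult_ac)
  qed
  then show ?thesis by (rule that)
qed

lemma ex_len_le_powr: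
  fixes r s :: nat and main err :: "nat \<Rightarrow> real"
  assumes "r + 3 \<le> s"
    and bound: "\<exists>c\<ge>0. \<forall>d\<ge>1. real (excess (s - r + 1) d) \<le> 2 powr (main d + c * err d)"
    and err: "\<And>d. 1 \<le> d \<Longrightarrow> 1 \<le> err d"
  shows "\<exists>e \<in> O(\<lambda>n. err (ackinv n)). \<forall>\<^sub>F n in sequentially. \<forall>u :: 'a list.
    num_symbols u = r \<and> length u = s \<longrightarrow>
      ereal_of_enat (ex_len u n) \<le> ereal (real n * 2 powr (main (ackinv n) + e n))"
proof -
  obtain D :: nat where D: "\<And>n (u :: 'a list). num_symbols u = r \<Longrightarrow> length u = s \<Longrightarrow>
    ereal_of_enat (ex_len u n) \<le> ereal (real n * (real D * real (excess (s - r + 1) (ackinv n))))"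
    using ex_len_le_excess[OF assms(1)] by blast
  obtain c where c: "c \<ge> 0" "\<And>d. 1 \<le> d \<Longrightarrow> real (excess (s - r + 1) d) \<le> 2 powr (main d + c * err d)"
    using bound by blast
  \<comment> \<open>The factor \<open>D\<close> is at most \<open>2 ^ D\<close> and moves into the
    exponent, where \<open>err \<ge> 1\<close> lets it join the error term.\<close>
  define e where "e n = (real D + c) * err (ackinv n)" for n
  have "real D * real (excess (s - r + 1) (ackinv n)) \<le> 2 powr (main (ackinv n) + e n)" for n
  proof -
    define d where "d = ackinv n"
    have d: "1 \<le> d" unfolding d_def by (rule ackinv_ge_1)
    have "real D * real (excess (s - r + 1) d) \<le> 2 powr real D * 2 powr (main d + c * err d)"
    proof (rule mult_mono)
      have "real D \<le> real (2 ^ D)" using less_exp[of D] by (intro of_nat_mono less_imp_le)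
      then show "real D \<le> 2 powr real D" by (simp add: powr_realpow)
    qed (use c(2)[OF d] in auto)
    also have "\<dots> = 2 powr (real D * 1 + (main d + c * err d))" by (simp add: powr_add)
    also have "\<dots> \<le> 2 powr (main d + (real D + c) * err d)"
      using mult_left_mono[OF err[OF d], of "real D"] by (intro powr_mono) (auto simp: algebra_simps)
    finally show ?thesis by (simp add: d_def e_def)
  qed
  then have "ereal_of_enat (ex_len u n) \<le> ereal (real n * 2 powr (main (ackinv n) + e n))"
    if "num_symbols u = r" "length u = s" for u :: "'a list" and n
    using D[OF that, of n] by (elim order.trans) (auto intro!: mult_left_mono)
  moreover have "e \<in> O(\<lambda>n. err (ackinv n))" unfolding e_def[abs_def] by simp
  ultimately show ?thesis by (intro bexI[of _ e]) auto
qed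

theorem theorem1p5:
  fixes r s t :: nat
  assumes "s \<ge> r + 3"
    and "t = nat \<lfloor>(real s - real r - 2) / 2\<rfloor>"
  shows "(even (s - r) \<longrightarrow>
           (\<exists>e :: nat \<Rightarrow> real. e \<in> O(\<lambda>n. real (ackinv n) ^ (t - 1)) \<and>
             (\<forall>\<^sub>F n in sequentially. \<forall>u :: 'a list.
                num_symbols u = r \<and> length u = s \<longrightarrow>
                ereal_of_enat (ex_len u n) \<le>
                  ereal (real n * 2 powr (1 / fact t * real (ackinv n) ^ t + e n)))))
       \<and> (odd (s - r) \<longrightarrow>
           (\<exists>e :: nat \<Rightarrow> real. e \<in> O(\<lambda>n. real (ackinv n) ^ t) \<and>
             (\<forall>\<^sub>F n in sequentially. \<forall>u :: 'a list.
                num_symbols u = r \<and> length u = s \<longrightarrow>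
                ereal_of_enat (ex_len u n) \<le>
                  ereal (real n * 2 powr
                    (1 / fact t * real (ackinv n) ^ t * log 2 (real (ackinv n)) + e n)))))"
proof -
  have t: "t = (s - r - 2) div 2"
  proof -
    have "real s - real r - 2 = real (s - r - 2)" using assms(1) by simp
    then have "\<lfloor>(real s - real r - 2) / 2\<rfloor> = int ((s - r - 2) div 2)"
      using floor_divide_of_nat_eq[of "s - r - 2" 2] by (simp only: of_nat_numeral)
    then show ?thesis using assms(2) by simp
  qed
  show ?thesis
  proof (intro conjI impI)
    assume "even (s - r)"
    then obtain w where w: "s - r = 2 * w" by (elim evenE)
    \<comment> \<open>By parity \<open>s - r\<close> is at least 4, so the subtraction is exact;
      even \<open>s - r\<close> corresponds to odd order.\<close>
    define q where "q = w - 2"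
    have sr: "s - r + 1 = 2 * q + 5" and tq: "t = Suc q"
      using w assms(1) unfolding t q_def by auto
    have "\<exists>c\<ge>0. \<forall>d\<ge>1. real (excess (s - r + 1) d) \<le>
        2 powr (1 / fact t * real d ^ t + c * real d ^ (t - 1))"
      using excess_odd_bound[of q] unfolding sr tq by (simp del: fact_Suc)
    then show "\<exists>e. e \<in> O(\<lambda>n. real (ackinv n) ^ (t - 1)) \<and>
        (\<forall>\<^sub>F n in sequentially. \<forall>u :: 'a list. num_symbols u = r \<and> length u = s \<longrightarrow>
          ereal_of_enat (ex_len u n) \<le> ereal (real n * 2 powr (1 / fact t * real (ackinv n) ^ t + e n)))"
      using ex_len_le_powr[OF assms(1), of "\<lambda>d. 1 / fact t * real d ^ t" "\<lambda>d. real d ^ (t - 1)"]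
      by (auto simp: Bex_def intro: one_le_power)
  next
    assume "odd (s - r)"
    then obtain w where w: "s - r = 2 * w + 1" by (elim oddE)
    define q where "q = w - 1"
    have sr: "s - r + 1 = 2 * q + 4" and tq: "t = q"
      using w assms(1) unfolding t q_def by auto
    have "\<exists>c\<ge>0. \<forall>d\<ge>1. real (excess (s - r + 1) d) \<le>
        2 powr (1 / fact t * real d ^ t * log 2 (real d) + c * real d ^ t)"
      using excess_even_bound[of q] unfolding sr tq by simp
    then show "\<exists>e. e \<in> O(\<lambda>n. real (ackinv n) ^ t) \<and>
        (\<forall>\<^sub>F n in sequentially. \<forall>u :: 'a list. num_symbols u = r \<and> length u = s \<longrightarrow>
          ereal_of_enat (ex_len u n) \<le>
            ereal (real n * 2 powr (1 / fact t * real (ackinv n) ^ t * log 2 (real (ackinv n)) + e n)))"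
      using ex_len_le_powr[OF assms(1), of "\<lambda>d. 1 / fact t * real d ^ t * log 2 (real d)" "\<lambda>d. real d ^ t"]
      by (auto simp: Bex_def intro: one_le_power)
  qed
qed

end
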